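(* Let $G=\overline{C_n}$ be the complement of a cycle $C_n$ of length $n\geq 4$ with vertex set $\{x_1,\ldots,x_n\}$, and let $S=K[x_1,\ldots,x_n]$ be a polynomial ring over a field $K$. If $\{z_1,z_2\}$ (with $z_1\ne z_2$) is an independent set of $G$, then there is a star-system of parameters of $S/I(G)$ associated to $\{z_1,z_2\}$.
   Context: Graphs are finite and simple; vertices are identified with the variables of $S$. The edge ideal of $G$ is $I(G)=(x_ix_j \mid \{x_i,x_j\}\in E(G))\subset S$, and $N_G(z)$ is the set of vertices adjacent to $z$. With $\mathfrak m=(x_1,\ldots,x_n)$, linear forms $f_1,\ldots,f_d\in S$ form a linear system of parameters for $S/I(G)$ if $d=\dim(S/I(G))$ and $\mathrm{rad}(I(G),f_1,\ldots,f_d)=\mathfrak m$; it is a 0-1 linear system of parameters if all coefficients of the $f_i$ lie in $\{0,1\}\subset K$. For $\{z_1,\ldots,z_d\}\subset V(G)$, a 0-1 linear system of parameters $\{f_1,\ldots,f_d\}$ of $S/I(G)$ is a star-system of parameters associated to $\{z_1,\ldots,z_d\}$ if for each $i$ one can write $f_i=z_i+\sum_{x_j\in A_i}x_j$ with $A_i\subset N_G(z_i)$. *)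

theory Defs
  imports
    "HOL-Algebra.QuotRing"
    "HOL-Library.Poly_Mapping"
    "HOL-Library.Extended_Nat"
begin

section \<open>Graphs\<close>

text \<open>A simple graph is given by its vertex set \<open>V\<close> and its set \<open>E\<close> of two-element edges.\<close>

definition cycle_graph :: "nat \<Rightarrow> 'v set \<Rightarrow> 'v set set \<Rightarrow> bool" where
  "cycle_graph n V E \<longleftrightarrow> n \<ge> 3 \<and>
     (\<exists>c. bij_betw c {..<n} V \<and> E = (\<lambda>i. {c i, c (Suc i mod n)}) ` {..<n})"

definition complement_edges :: "'v set \<Rightarrow> 'v set set \<Rightarrow> 'v set set" where
  "complement_edges V E = {e. e \<subseteq> V \<and> card e = 2 \<and> e \<notin> E}"

definition independent_set :: "'v set \<Rightarrow> 'v set set \<Rightarrow> 'v set \<Rightarrow> bool" where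
  "independent_set V E W \<longleftrightarrow> W \<subseteq> V \<and> (\<forall>u\<in>W. \<forall>v\<in>W. {u, v} \<notin> E)"

definition neighbourhood :: "'v set set \<Rightarrow> 'v \<Rightarrow> 'v set" where
  "neighbourhood E z = {v. {z, v} \<in> E}"

section \<open>Polynomial rings and ideals\<close>

text \<open>A monomial is a finitely supported exponent vector, and a polynomial a finitely supported
  family of coefficients; the ring structure on \<open>poly_mapping\<close> is convolution.\<close>

type_synonym ('v, 'k) mpoly = "('v \<Rightarrow>\<^sub>0 nat) \<Rightarrow>\<^sub>0 'k"

definition mvar :: "'v \<Rightarrow> ('v, 'k::comm_ring_1) mpoly" where
  "mvar i = Poly_Mapping.single (Poly_Mapping.single i 1) 1"

definition mconst :: "'k \<Rightarrow> ('v, 'k::comm_ring_1) mpoly" where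
  "mconst a = Poly_Mapping.single 0 a"

definition mpoly_ring :: "'v set \<Rightarrow> ('v, 'k::comm_ring_1) mpoly ring" where
  "mpoly_ring V = \<lparr>carrier = {p. \<forall>m\<in>Poly_Mapping.keys p. Poly_Mapping.keys m \<subseteq> V},
     mult = (*), one = 1, zero = 0, add = (+)\<rparr>"

lemma cring_mpoly_ring: "cring (mpoly_ring V :: ('v, 'k::comm_ring_1) mpoly ring)"
proof -
  let ?C = "carrier (mpoly_ring V :: ('v, 'k) mpoly ring)"
  have C: "p \<in> ?C \<longleftrightarrow> (\<forall>m\<in>Poly_Mapping.keys p. Poly_Mapping.keys m \<subseteq> V)" for p
    by (simp add: mpoly_ring_def)
  have ops [simp]: "mult (mpoly_ring V :: ('v, 'k) mpoly ring) = (*)"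
    "one (mpoly_ring V :: ('v, 'k) mpoly ring) = 1"
    "zero (mpoly_ring V :: ('v, 'k) mpoly ring) = 0"
    "add (mpoly_ring V :: ('v, 'k) mpoly ring) = (+)"
    by (simp_all add: mpoly_ring_def)
  have zero: "0 \<in> ?C" and one: "1 \<in> ?C"
    by (simp_all add: C)
  have add: "p + q \<in> ?C" if "p \<in> ?C" "q \<in> ?C" for p q
    using that Poly_Mapping.keys_add[of p q] unfolding C by blast
  have uminus: "- p \<in> ?C" if "p \<in> ?C" for p
    using that unfolding C by (simp add: in_keys_iff)
  have mult: "p * q \<in> ?C" if "p \<in> ?C" "q \<in> ?C" for p q
    unfolding C
  proof
    fix m assume "m \<in> Poly_Mapping.keys (p * q)"
    then obtain a b where ab: "m = a + b" "a \<in> Poly_Mapping.keys p" "b \<in> Poly_Mapping.keys q"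
      using keys_mult[of p q] by blast
    have "Poly_Mapping.keys a \<subseteq> V" "Poly_Mapping.keys b \<subseteq> V"
      using that ab(2,3) unfolding C by blast+
    then show "Poly_Mapping.keys m \<subseteq> V"
      using Poly_Mapping.keys_add[of a b] unfolding ab(1) by blast
  qed
  show ?thesis
  proof (rule cringI)
    show "abelian_group (mpoly_ring V :: ('v, 'k) mpoly ring)"
    proof (rule abelian_groupI, unfold ops)
      fix p assume "p \<in> ?C"
      then show "\<exists>q\<in>?C. q + p = 0"
        using uminus by (metis add.left_inverse)
    qed (simp_all only: add zero add.assoc add_0_left, simp only: add.commute)
    show "comm_monoid (mpoly_ring V :: ('v, 'k) mpoly ring)"
      by (rule comm_monoidI, unfold ops)
        (simp_all only: mult one mult.assoc mult_1_left, simp only: mult.commute)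
  qed (simp add: distrib_right)
qed

definition radical :: "('a, 'b) ring_scheme \<Rightarrow> 'a set \<Rightarrow> 'a set" where
  "radical R I = {a \<in> carrier R. \<exists>k>0::nat. a [^]\<^bsub>R\<^esub> k \<in> I}"

text \<open>Krull dimension: the supremum of the lengths \<open>l\<close> of chains
  \<open>P 0 \<subset> P 1 \<subset> \<dots> \<subset> P l\<close> of prime ideals. The zero ring, which has no prime ideals,
  gets the value \<open>0\<close> here.\<close>

definition krull_dim :: "('a, 'b) ring_scheme \<Rightarrow> enat" where
  "krull_dim R = (SUP l \<in> {l. \<exists>P. (\<forall>i\<le>l. primeideal (P i) R) \<and> (\<forall>i<l. P i \<subset> P (Suc i))}. enat l)"

section \<open>Edge ideals and systems of parameters\<close>

definition edge_ideal :: "'v set \<Rightarrow> 'v set set \<Rightarrow> ('v, 'k::comm_ring_1) mpoly set" where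
  "edge_ideal V E = Idl\<^bsub>mpoly_ring V\<^esub> {mvar i * mvar j | i j. {i, j} \<in> E}"

definition max_irrelevant_ideal :: "'v set \<Rightarrow> ('v, 'k::comm_ring_1) mpoly set" where
  "max_irrelevant_ideal V = Idl\<^bsub>mpoly_ring V\<^esub> (mvar ` V)"

definition linear_form :: "'v set \<Rightarrow> ('v, 'k::comm_ring_1) mpoly \<Rightarrow> bool" where
  "linear_form V f \<longleftrightarrow> (\<exists>a. f = (\<Sum>i\<in>V. mconst (a i) * mvar i))"

definition linear_sop ::
  "'v set \<Rightarrow> 'v set set \<Rightarrow> ('v, 'k::field) mpoly list \<Rightarrow> bool" where
  "linear_sop V E fs \<longleftrightarrow>
     (\<forall>f\<in>set fs. linear_form V f) \<and>
     enat (length fs) =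
       krull_dim (mpoly_ring V Quot (edge_ideal V E :: ('v, 'k) mpoly set)) \<and>
     radical (mpoly_ring V) (Idl\<^bsub>mpoly_ring V\<^esub> (edge_ideal V E \<union> set fs)) =
       max_irrelevant_ideal V"

definition zero_one_linear_sop ::
  "'v set \<Rightarrow> 'v set set \<Rightarrow> ('v, 'k::field) mpoly list \<Rightarrow> bool" where
  "zero_one_linear_sop V E fs \<longleftrightarrow>
     linear_sop V E fs \<and> (\<forall>f\<in>set fs. \<forall>m. Poly_Mapping.lookup f m \<in> {0, 1})"

definition star_sop ::
  "'v set \<Rightarrow> 'v set set \<Rightarrow> 'v list \<Rightarrow> ('v, 'k::field) mpoly list \<Rightarrow> bool" where
  "star_sop V E zs fs \<longleftrightarrow>
     distinct zs \<and> set zs \<subseteq> V \<and> zero_one_linear_sop V E fs \<and> length fs = length zs \<and>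
     (\<forall>i<length zs. \<exists>A. A \<subseteq> neighbourhood E (zs ! i) \<and>
        fs ! i = mvar (zs ! i) + (\<Sum>j\<in>A. mvar j))"

end

theory Submission
  imports Defs
begin

text \<open>
  Since \<open>n \<ge> 4\<close>, the independent sets of \<open>G\<close> are the cliques of the cycle, that is, at most two
  consecutive vertices. Give each vertex \<open>v\<close> the vector of its coefficients in \<open>f\<^sub>1\<close> and \<open>f\<^sub>2\<close>. If these
  \<open>0\<close>-\<open>1\<close>-vectors are nonzero and distinct at consecutive vertices \<open>u\<close>, \<open>v\<close>, then multiplying a
  separating \<open>f\<^sub>i\<close> by \<open>x\<^sub>u x\<^sub>v\<close> kills all but one term modulo \<open>I(G)\<close> and puts \<open>x\<^sub>u x\<^sub>v\<close> into the
  radical; multiplying a form that contains \<open>x\<^sub>u\<close> by \<open>x\<^sub>u\<close> then puts \<open>x\<^sub>u\<^sup>2\<close> there. Suitable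
  vectors are read off from the parity of the position on the cycle counted from \<open>z\<^sub>1\<close>.

  The dimension is at least \<open>2\<close> because of the primes generated by variables. For the upper bound,
  a prime over \<open>I(G)\<close> contains all variables except at most two, so modulo it any three polynomials
  satisfy a nontrivial polynomial relation, by counting monomials. Take \<open>y\<^sub>i \<in> P\<^sub>i - P\<^sub>i\<^sub>-\<^sub>1\<close> along
  a chain of length \<open>3\<close>: cancelling powers of \<open>y\<^sub>1\<close>, \<open>y\<^sub>2\<close>, \<open>y\<^sub>3\<close> in turn in a relation of
  these elements moves its lexicographically lowest coefficient, a unit, into \<open>P\<^sub>3\<close>.
\<close>

section \<open>Primes and dimension of a quotient ring\<close>

text \<open>Representatives of one coset differ by elements of \<open>I\<close>, which
  \<open>I \<subseteq> Q\<close> absorbs; so membership in the image of \<open>Q\<close> can be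
  tested on any representative.\<close>

lemma (in ideal) rcos_mem_image_iff:
  assumes "ideal Q R" and "I \<subseteq> Q" and "a \<in> carrier R"
  shows "I +> a \<in> (+>) I ` Q \<longleftrightarrow> a \<in> Q"
proof
  assume "I +> a \<in> (+>) I ` Q"
  then obtain b where b: "b \<in> Q" "I +> a = I +> b"
    by blast
  interpret Q: ideal Q R by fact
  have "a \<in> I +> b"
    using a_rcos_self[OF assms(3)] b(2) by simp
  then obtain h where "h \<in> I" "a = h \<oplus> b"
    by (auto simp: a_r_coset_def')
  then show "a \<in> Q"
    using assms(2) b(1) by (metis Q.a_closed subsetD)
qed blast

lemma (in ideal) FactRing_carrierE:
  assumes "A \<in> carrier (R Quot I)"
  obtains a where "a \<in> carrier R" "A = I +> a"
  using assms by (auto simp: FactRing_simps)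

lemma (in ideal) primeideal_quot_image:
  assumes "primeideal Q R" and "I \<subseteq> Q"
  shows "primeideal ((+>) I ` Q) (R Quot I)"
proof -
  interpret Q: primeideal Q R by fact
  note mem = rcos_mem_image_iff[OF Q.is_ideal assms(2)]
  show ?thesis
  proof (rule primeidealI)
    show "ideal ((+>) I ` Q) (R Quot I)"
      by (rule ring_ideal_imp_quot_ideal[OF ideal_axioms Q.is_ideal])
    show "cring (R Quot I)"
      by (rule quotient_is_cring) (rule Q.is_cring)
    have "I +> \<one> \<notin> (+>) I ` Q"
      using mem[OF one_closed] Q.one_imp_carrier Q.I_notcarr by blast
    moreover have "I +> \<one> \<in> carrier (R Quot I)"
      by (auto simp: FactRing_simps)
    ultimately show "carrier (R Quot I) \<noteq> (+>) I ` Q"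
      by blast
  next
    fix A B assume A: "A \<in> carrier (R Quot I)" and B: "B \<in> carrier (R Quot I)"
      and AB: "A \<otimes>\<^bsub>R Quot I\<^esub> B \<in> (+>) I ` Q"
    obtain a b where ab: "a \<in> carrier R" "A = I +> a" "b \<in> carrier R" "B = I +> b"
      by (metis A B FactRing_carrierE)
    have "I +> a \<otimes> b \<in> (+>) I ` Q"
      using AB ab by (simp add: FactRing_def rcoset_mult_add)
    then show "A \<in> (+>) I ` Q \<or> B \<in> (+>) I ` Q"
      using ab mem Q.I_prime by auto
  qed
qed

text \<open>Preimages and images under the coset map turn primes of the quotient into primes over
  \<open>I\<close> and back, and keep inclusions strict. Dimensions can thus be computed with chains
  in the ring itself.\<close>

lemma (in cring) krull_dim_quot:
  assumes "ideal I R"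
  shows "krull_dim (R Quot I) =
    (SUP l \<in> {l. \<exists>P. (\<forall>i\<le>l. primeideal (P i) R \<and> I \<subseteq> P i) \<and> (\<forall>i<l. P i \<subset> P (Suc i))}. enat l)"
proof -
  interpret I: ideal I R by fact
  interpret h: ring_hom_ring R "R Quot I" "(+>) I"
    by (rule I.rcos_ring_hom_ring)
  have "(\<exists>P. (\<forall>i\<le>l. primeideal (P i) (R Quot I)) \<and> (\<forall>i<l. P i \<subset> P (Suc i))) \<longleftrightarrow>
      (\<exists>P. (\<forall>i\<le>l. primeideal (P i) R \<and> I \<subseteq> P i) \<and> (\<forall>i<l. P i \<subset> P (Suc i)))" (is "?L \<longleftrightarrow> ?R")
    for l :: nat
  proof
    assume ?L
    then obtain P where P: "\<And>i. i \<le> l \<Longrightarrow> primeideal (P i) (R Quot I)"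
      "\<And>i. i < l \<Longrightarrow> P i \<subset> P (Suc i)"
      by blast
    define Q where "Q i = {a \<in> carrier R. I +> a \<in> P i}" for i
    have "primeideal (Q i) R" if "i \<le> l" for i
      unfolding Q_def using h.primeideal_vimage[OF is_cring P(1)[OF that]] .
    moreover have "I \<subseteq> Q i" if "i \<le> l" for i
    proof
      fix a assume a: "a \<in> I"
      have "\<zero>\<^bsub>R Quot I\<^esub> \<in> P i"
        by (rule additive_subgroup.zero_closed[OF ideal.axioms(1)[OF primeideal.axioms(1)[OF P(1)[OF that]]]])
      then have "I +> a \<in> P i"
        unfolding a_rcos_zero[OF assms a] by (simp only: FactRing_def ring.simps)
      then show "a \<in> Q i"
        unfolding Q_def using I.Icarr[OF a] by blast
    qed
    moreover have "Q i \<subset> Q (Suc i)" if il: "i < l" for i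
    proof -
      obtain A where A: "A \<in> P (Suc i)" "A \<notin> P i"
        using P(2)[OF il] by blast
      have "A \<in> carrier (R Quot I)"
        using ideal.Icarr[OF primeideal.axioms(1)[OF P(1)] A(1)] il by simp
      then obtain a where "a \<in> carrier R" "A = I +> a"
        by (rule I.FactRing_carrierE)
      then have "a \<in> Q (Suc i)" "a \<notin> Q i"
        using A by (auto simp: Q_def)
      moreover have "Q i \<subseteq> Q (Suc i)"
        using P(2)[OF il] by (auto simp: Q_def)
      ultimately show ?thesis
        by blast
    qed
    ultimately show ?R
      by (intro exI[of _ Q]) simp
  next
    assume ?R
    then obtain P where P: "\<And>i. i \<le> l \<Longrightarrow> primeideal (P i) R" "\<And>i. i \<le> l \<Longrightarrow> I \<subseteq> P i"
      "\<And>i. i < l \<Longrightarrow> P i \<subset> P (Suc i)"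
      by blast
    have "primeideal ((+>) I ` P i) (R Quot I)" if "i \<le> l" for i
      using I.primeideal_quot_image P that by blast
    moreover have "(+>) I ` P i \<subset> (+>) I ` P (Suc i)" if il: "i < l" for i
    proof -
      obtain a where a: "a \<in> P (Suc i)" "a \<notin> P i"
        using P(3)[OF il] by blast
      have "a \<in> carrier R"
        using ideal.Icarr[OF primeideal.axioms(1)[OF P(1)] a(1)] il by simp
      then have "I +> a \<notin> (+>) I ` P i"
        using I.rcos_mem_image_iff[OF primeideal.axioms(1)[OF P(1)] P(2)] a(2) il by simp
      then show ?thesis
        using P(3)[OF il] a(1) by blast
    qed
    ultimately show ?L
      by (intro exI[of _ "\<lambda>i. (+>) I ` P i"]) simp
  qed
  then show ?thesis
    by (simp add: krull_dim_def)
qed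

section \<open>The polynomial ring and its ideals\<close>

lemma mpoly_ring_simps [simp]:
  "mult (mpoly_ring V) = (*)" "one (mpoly_ring V) = 1"
  "zero (mpoly_ring V) = 0" "add (mpoly_ring V) = (+)"
  by (simp_all add: mpoly_ring_def)

lemma mpoly_carrier_iff:
  "p \<in> carrier (mpoly_ring V) \<longleftrightarrow> (\<forall>m\<in>Poly_Mapping.keys p. Poly_Mapping.keys m \<subseteq> V)"
  by (simp add: mpoly_ring_def)

section \<open>Ideals and primes of the polynomial ring in terms of type-class arithmetic\<close>

context
  fixes V :: "'v set" and R :: "('v, 'k::comm_ring_1) mpoly ring"
  defines "R \<equiv> mpoly_ring V"
begin

interpretation R: cring R
  unfolding R_def by (rule cring_mpoly_ring)

lemma mpoly_carrier_closed:
  shows mpoly_carrier_0: "0 \<in> carrier R" and mpoly_carrier_1: "1 \<in> carrier R"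
    and mpoly_carrier_add: "\<And>p q. p \<in> carrier R \<Longrightarrow> q \<in> carrier R \<Longrightarrow> p + q \<in> carrier R"
    and mpoly_carrier_mult: "\<And>p q. p \<in> carrier R \<Longrightarrow> q \<in> carrier R \<Longrightarrow> p * q \<in> carrier R"
  using R.zero_closed R.one_closed R.a_closed R.m_closed by (simp_all add: R_def)

lemma mpoly_carrier_uminus: "p \<in> carrier R \<Longrightarrow> - p \<in> carrier R"
  by (simp add: R_def mpoly_carrier_iff in_keys_iff)

lemma mpoly_a_inv: "p \<in> carrier R \<Longrightarrow> \<ominus>\<^bsub>R\<^esub> p = - p"
  using mpoly_carrier_uminus by (intro R.minus_equality) (simp_all add: R_def)

lemma mpoly_carrier_power: "p \<in> carrier R \<Longrightarrow> p ^ n \<in> carrier R"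
  by (induction n) (simp_all add: mpoly_carrier_closed)

lemma mpoly_carrier_sum:
  "(\<And>i. i \<in> A \<Longrightarrow> f i \<in> carrier R) \<Longrightarrow> sum f A \<in> carrier R"
  by (induction A rule: infinite_finite_induct) (simp_all add: mpoly_carrier_closed)

lemma mpoly_carrier_of_nat: "of_nat n \<in> carrier R"
  by (induction n) (simp_all add: mpoly_carrier_closed)

lemma mpoly_carrier_mconst: "mconst a \<in> carrier R"
  by (auto simp: R_def mpoly_carrier_iff mconst_def)

lemma mpoly_carrier_mvar: "i \<in> V \<Longrightarrow> mvar i \<in> carrier R"
  by (auto simp: R_def mpoly_carrier_iff mvar_def)

lemma mpoly_nat_pow: "p [^]\<^bsub>R\<^esub> (n::nat) = p ^ n"
proof (induction n)
  case (Suc n)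
  have "p [^]\<^bsub>R\<^esub> Suc n = p [^]\<^bsub>R\<^esub> n \<otimes>\<^bsub>R\<^esub> p"
    by (rule R.nat_pow_Suc)
  then show ?case
    using Suc.IH by (simp add: R_def mult.commute)
qed (simp add: R_def)

text \<open>Negation is multiplication by the carrier element \<open>- 1\<close>, so the absorption
  clause also covers additive inverses.\<close>

lemma ideal_mpoly_ring_iff:
  "ideal Q R \<longleftrightarrow> Q \<subseteq> carrier R \<and> 0 \<in> Q \<and> (\<forall>p\<in>Q. \<forall>q\<in>Q. p + q \<in> Q) \<and>
     (\<forall>p\<in>carrier R. \<forall>q\<in>Q. p * q \<in> Q)" (is "_ \<longleftrightarrow> ?Q")
proof
  assume "ideal Q R"
  then interpret Q: ideal Q R .
  show ?Q
    using Q.Icarr Q.zero_closed Q.a_closed Q.I_l_closed by (auto simp: R_def)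
next
  assume Q: ?Q
  show "ideal Q R"
  proof (rule idealI)
    show "subgroup Q (add_monoid R)"
    proof (rule R.add.subgroupI)
      fix p assume p: "p \<in> Q"
      then have pC: "p \<in> carrier R"
        using Q by blast
      have "(- 1) * p \<in> Q"
        using Q p mpoly_carrier_uminus[OF mpoly_carrier_1] by blast
      then show "\<ominus>\<^bsub>R\<^esub> p \<in> Q"
        by (simp add: mpoly_a_inv[OF pC])
    qed (use Q in \<open>auto simp: R_def\<close>)
    show "ring R" ..
    show "x \<otimes>\<^bsub>R\<^esub> a \<in> Q" if "a \<in> Q" "x \<in> carrier R" for a x
      using Q that by (simp add: R_def)
    then show "a \<otimes>\<^bsub>R\<^esub> x \<in> Q" if "a \<in> Q" "x \<in> carrier R" for a x
      using that by (simp add: R_def mult.commute)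
  qed
qed

lemma ideal_mpoly_closed:
  assumes "ideal Q R"
  shows ideal_mpoly_subset: "Q \<subseteq> carrier R" and ideal_mpoly_0: "0 \<in> Q"
    and ideal_mpoly_add: "\<And>p q. p \<in> Q \<Longrightarrow> q \<in> Q \<Longrightarrow> p + q \<in> Q"
    and ideal_mpoly_mult: "\<And>p q. p \<in> carrier R \<Longrightarrow> q \<in> Q \<Longrightarrow> p * q \<in> Q"
  using assms by (auto simp: ideal_mpoly_ring_iff)

lemma ideal_mpoly_diff:
  assumes "ideal Q R" "p \<in> Q" "q \<in> Q"
  shows "p - q \<in> Q"
proof -
  have "(- 1) * q \<in> Q"
    using assms mpoly_carrier_uminus[OF mpoly_carrier_1] by (intro ideal_mpoly_mult)
  then have "p + (- 1) * q \<in> Q"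
    by (intro ideal_mpoly_add assms)
  then show ?thesis
    by simp
qed

lemma ideal_mpoly_sum:
  assumes "ideal Q R" and "\<And>i. i \<in> A \<Longrightarrow> f i \<in> Q"
  shows "sum f A \<in> Q"
  using assms(2)
  by (induction A rule: infinite_finite_induct) (simp_all add: ideal_mpoly_closed[OF assms(1)])

lemma primeideal_mpoly_ring_iff:
  "primeideal Q R \<longleftrightarrow> ideal Q R \<and> 1 \<notin> Q \<and>
     (\<forall>p\<in>carrier R. \<forall>q\<in>carrier R. p * q \<in> Q \<longrightarrow> p \<in> Q \<or> q \<in> Q)" (is "_ \<longleftrightarrow> ?Q")
proof
  assume "primeideal Q R"
  then interpret Q: primeideal Q R .
  have "1 \<notin> Q"
    using Q.one_imp_carrier Q.I_notcarr by (auto simp: R_def)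
  then show ?Q
    using Q.is_ideal Q.I_prime by (auto simp: R_def)
next
  assume Q: ?Q
  have "carrier R \<noteq> Q"
    using Q mpoly_carrier_1 by blast
  then show "primeideal Q R"
    using Q by (intro primeidealI R.is_cring) (auto simp: R_def)
qed

lemma primeideal_mpoly_power:
  assumes "primeideal Q R" "p \<in> carrier R" "p ^ n \<in> Q"
  shows "p \<in> Q"
  using assms(3)
proof (induction n)
  case (Suc n)
  then show ?case
    using assms(1,2) mpoly_carrier_power[OF assms(2)]
    by (auto simp: primeideal_mpoly_ring_iff)
qed (use assms(1) in \<open>simp add: primeideal_mpoly_ring_iff\<close>)

section \<open>Radicals of ideals\<close>

lemma mem_radical_mpoly_iff:
  "p \<in> radical R J \<longleftrightarrow> p \<in> carrier R \<and> (\<exists>k>0. p ^ k \<in> J)"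
  by (simp add: radical_def mpoly_nat_pow)

text \<open>For sums: in each term of the binomial expansion of \<open>(p + q) ^ (k + l)\<close>,
  either \<open>p\<close> has exponent at least \<open>k\<close> or \<open>q\<close> has exponent at
  least \<open>l\<close>.\<close>

lemma ideal_radical:
  assumes J: "ideal J R"
  shows "ideal (radical R J) R"
  unfolding ideal_mpoly_ring_iff
proof (intro conjI ballI)
  show "radical R J \<subseteq> carrier R"
    by (auto simp: radical_def)
  show "0 \<in> radical R J"
    using ideal_mpoly_0[OF J] mpoly_carrier_0 by (auto simp: mem_radical_mpoly_iff intro!: exI[of _ 1])
next
  fix p q assume "p \<in> radical R J" "q \<in> radical R J"
  then obtain k l where p: "p \<in> carrier R" "k > 0" "p ^ k \<in> J"
    and q: "q \<in> carrier R" "l > 0" "q ^ l \<in> J"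
    by (auto simp: mem_radical_mpoly_iff)
  have "(p + q) ^ (k + l) = (\<Sum>i\<le>k + l. of_nat (k + l choose i) * p ^ i * q ^ (k + l - i))"
    by (rule binomial_ring)
  also have "\<dots> \<in> J"
  proof (rule ideal_mpoly_sum[OF J])
    fix i assume "i \<in> {..k + l}"
    show "of_nat (k + l choose i) * p ^ i * q ^ (k + l - i) \<in> J"
    proof (cases "k \<le> i")
      case True
      then have "p ^ i = p ^ (i - k) * p ^ k"
        by (simp flip: power_add)
      then have "of_nat (k + l choose i) * p ^ i * q ^ (k + l - i) =
          (of_nat (k + l choose i) * p ^ (i - k) * q ^ (k + l - i)) * p ^ k"
        by (simp only: ac_simps)
      then show ?thesis
        using p q by (metis ideal_mpoly_mult[OF J] mpoly_carrier_mult mpoly_carrier_of_nat mpoly_carrier_power)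
    next
      case False
      then have "k + l - i = (k - i) + l"
        by simp
      then have "of_nat (k + l choose i) * p ^ i * q ^ (k + l - i) =
          (of_nat (k + l choose i) * p ^ i * q ^ (k - i)) * q ^ l"
        by (simp add: ac_simps power_add)
      then show ?thesis
        using p q by (metis ideal_mpoly_mult[OF J] mpoly_carrier_mult mpoly_carrier_of_nat mpoly_carrier_power)
    qed
  qed
  finally show "p + q \<in> radical R J"
    using p q by (auto simp: mem_radical_mpoly_iff mpoly_carrier_add intro!: exI[of _ "k + l"])
next
  fix p q assume p: "p \<in> carrier R" and "q \<in> radical R J"
  then obtain k where q: "q \<in> carrier R" "k > 0" "q ^ k \<in> J"
    by (auto simp: mem_radical_mpoly_iff)
  have "(p * q) ^ k \<in> J"
    using p q by (simp add: power_mult_distrib ideal_mpoly_mult[OF J] mpoly_carrier_power)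
  then show "p * q \<in> radical R J"
    using p q by (auto simp: mem_radical_mpoly_iff mpoly_carrier_mult)
qed

lemma subset_radical:
  assumes "ideal J R"
  shows "J \<subseteq> radical R J"
  using ideal_mpoly_subset[OF assms] by (auto simp: mem_radical_mpoly_iff intro!: exI[of _ 1])

lemma radical_subset_primeideal:
  assumes "primeideal P R" and "J \<subseteq> P"
  shows "radical R J \<subseteq> P"
  using assms(2) primeideal_mpoly_power[OF assms(1)]
  by (meson mem_radical_mpoly_iff subset_iff)

lemma radical_power:
  assumes "p \<in> carrier R" and "p ^ n \<in> radical R J" and "n > 0"
  shows "p \<in> radical R J"
proof -
  obtain k where "k > 0" "(p ^ n) ^ k \<in> J"
    using assms(2) by (auto simp: mem_radical_mpoly_iff)
  then show ?thesis
    using assms by (auto simp: mem_radical_mpoly_iff simp flip: power_mult intro!: exI[of _ "n * k"])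
qed

end

section \<open>Ideals generated by variables\<close>

text \<open>This is the ideal generated by the variables in \<open>V - W\<close>, the kernel of
  setting them to zero. The description by monomials reduces membership to inspecting coefficients;
  \<open>W\<close> collects the variables that survive.\<close>

definition var_ideal :: "'v set \<Rightarrow> 'v set \<Rightarrow> ('v, 'k::comm_ring_1) mpoly set" where
  "var_ideal V W =
     {p \<in> carrier (mpoly_ring V). \<forall>m\<in>Poly_Mapping.keys p. \<not> Poly_Mapping.keys m \<subseteq> W}"

lemma keys_plus_nat: "Poly_Mapping.keys (a + b) = Poly_Mapping.keys a \<union> Poly_Mapping.keys b"
  for a b :: "'v \<Rightarrow>\<^sub>0 nat"
  by (auto simp: in_keys_iff lookup_add)

lemma mvar_mult: "mvar i * mvar j = Poly_Mapping.single (Poly_Mapping.single i 1 + Poly_Mapping.single j 1) 1"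
  by (simp add: mvar_def mult_single)

lemma lookup_mconst_mult:
  "Poly_Mapping.lookup (mconst a * p) m = a * Poly_Mapping.lookup p m"
  by (simp add: mconst_def map.rep_eq when_def flip: mult_map_scale_conv_mult)

lemma mpoly_eq_sum_single:
  "p = (\<Sum>m\<in>Poly_Mapping.keys p. Poly_Mapping.single m (Poly_Mapping.lookup p m))"
  by (rule poly_mapping_eqI)
    (simp add: lookup_sum lookup_single when_def sum.delta in_keys_iff)

lemma ideal_var_ideal: "ideal (var_ideal V W :: ('v, 'k::comm_ring_1) mpoly set) (mpoly_ring V)"
  unfolding ideal_mpoly_ring_iff
proof (intro conjI ballI)
  fix p q :: "('v, 'k) mpoly" assume "p \<in> var_ideal V W" "q \<in> var_ideal V W"
  then show "p + q \<in> var_ideal V W"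
    using Poly_Mapping.keys_add[of p q] mpoly_carrier_add[of p V q] by (auto simp: var_ideal_def)
next
  fix p q :: "('v, 'k) mpoly" assume p: "p \<in> carrier (mpoly_ring V)" and q: "q \<in> var_ideal V W"
  have "\<not> Poly_Mapping.keys m \<subseteq> W" if m: "m \<in> Poly_Mapping.keys (p * q)" for m
  proof -
    obtain a b where "m = a + b" "b \<in> Poly_Mapping.keys q"
      using m keys_mult[of p q] by blast
    then show ?thesis
      using q by (auto simp: var_ideal_def keys_plus_nat)
  qed
  then show "p * q \<in> var_ideal V W"
    using mpoly_carrier_mult[OF p] q by (simp add: var_ideal_def)
qed (auto simp: var_ideal_def mpoly_carrier_0)

lemma mvar_mem_var_ideal_iff: "i \<in> V \<Longrightarrow> mvar i \<in> var_ideal V W \<longleftrightarrow> i \<notin> W"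
  by (simp add: var_ideal_def mpoly_carrier_mvar) (simp add: mvar_def)

lemma mvar_mult_mem_var_ideal:
  assumes "i \<in> V" "j \<in> V" "\<not> {i, j} \<subseteq> W"
  shows "(mvar i * mvar j :: ('v, 'k::comm_ring_1) mpoly) \<in> var_ideal V W"
proof -
  have "Poly_Mapping.keys m = {i, j}" if "m \<in> Poly_Mapping.keys (mvar i * mvar j :: ('v, 'k) mpoly)" for m
    using that by (auto simp: mvar_mult keys_plus_nat split: if_splits)
  moreover have "(mvar i * mvar j :: ('v, 'k) mpoly) \<in> carrier (mpoly_ring V)"
    by (intro mpoly_carrier_mult mpoly_carrier_mvar assms)
  ultimately show ?thesis
    using assms(3) by (auto simp: var_ideal_def)
qed

text \<open>Let \<open>r\<close> discard all terms with a variable outside \<open>W\<close>. Modulo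
  the ideal, \<open>p * q\<close> agrees with \<open>r p * r q\<close>, which has only monomials on
  \<open>W\<close>; if it lies in the ideal, it is zero, and the absence of zero divisors applies.
  The linear order on variables orders the monomials, on which that absence rests.\<close>

lemma primeideal_var_ideal:
  "primeideal (var_ideal V W :: ('v::linorder, 'k::idom) mpoly set) (mpoly_ring V)"
  unfolding primeideal_mpoly_ring_iff
proof (intro conjI ballI impI)
  let ?J = "var_ideal V W :: ('v, 'k) mpoly set"
  show id: "ideal ?J (mpoly_ring V)"
    by (rule ideal_var_ideal)
  show "1 \<notin> ?J"
    by (simp add: var_ideal_def)
  fix p q :: "('v, 'k) mpoly"
  assume p: "p \<in> carrier (mpoly_ring V)" and q: "q \<in> carrier (mpoly_ring V)" and pq: "p * q \<in> ?J"
  define r :: "('v, 'k) mpoly \<Rightarrow> ('v, 'k) mpoly"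
    where "r p = Poly_Mapping.mapp (\<lambda>m c. if Poly_Mapping.keys m \<subseteq> W then c else 0) p" for p
  have lookup_r: "Poly_Mapping.lookup (r p) m = (if Poly_Mapping.keys m \<subseteq> W then Poly_Mapping.lookup p m else 0)" for p m
    by (simp add: r_def lookup_mapp when_def in_keys_iff)
  have rW: "Poly_Mapping.keys m \<subseteq> W" if "m \<in> Poly_Mapping.keys (r p)" for m p
    using that by (auto simp: in_keys_iff lookup_r split: if_splits)
  have r_carrier: "r p \<in> carrier (mpoly_ring V)" if "p \<in> carrier (mpoly_ring V)" for p
    using that by (auto simp: mpoly_carrier_iff in_keys_iff lookup_r split: if_splits)
  have diff: "p - r p \<in> ?J" if "p \<in> carrier (mpoly_ring V)" for p
    using that by (auto simp: var_ideal_def mpoly_carrier_iff in_keys_iff lookup_minus lookup_r split: if_splits)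
  have "p * q - (q * (p - r p) + r p * (q - r q)) \<in> ?J"
    by (intro ideal_mpoly_diff[OF id] ideal_mpoly_add[OF id] ideal_mpoly_mult[OF id] pq p q diff r_carrier)
  then have rr: "r p * r q \<in> ?J"
    by (simp add: algebra_simps)
  have "Poly_Mapping.keys (r p * r q) = {}"
  proof (rule equals0I)
    fix m assume m: "m \<in> Poly_Mapping.keys (r p * r q)"
    then obtain a b where "m = a + b" "a \<in> Poly_Mapping.keys (r p)" "b \<in> Poly_Mapping.keys (r q)"
      using keys_mult[of "r p" "r q"] by blast
    then have "Poly_Mapping.keys m \<subseteq> W"
      using rW by (simp add: keys_plus_nat)
    then show False
      using rr m by (simp add: var_ideal_def)
  qed
  then have "r p * r q = 0"
    by simp
  then have "r p = 0 \<or> r q = 0"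
    by simp
  then show "p \<in> ?J \<or> q \<in> ?J"
    using diff[OF p] diff[OF q] by auto
qed

text \<open>Each term of a member is divisible by a variable of \<open>V - W\<close>, hence lies in
  \<open>Q\<close>; a polynomial is the sum of its terms.\<close>

lemma var_ideal_subset:
  fixes Q :: "('v, 'k::comm_ring_1) mpoly set"
  assumes Q: "ideal Q (mpoly_ring V)" and var: "\<And>i. i \<in> V - W \<Longrightarrow> mvar i \<in> Q"
  shows "var_ideal V W \<subseteq> Q"
proof
  fix p :: "('v, 'k) mpoly" assume p: "p \<in> var_ideal V W"
  have "Poly_Mapping.single m (Poly_Mapping.lookup p m) \<in> Q" if m: "m \<in> Poly_Mapping.keys p" for m
  proof -
    obtain i where i: "i \<in> Poly_Mapping.keys m" "i \<notin> W"
      using p m by (auto simp: var_ideal_def)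
    have mV: "Poly_Mapping.keys m \<subseteq> V"
      using p m by (auto simp: var_ideal_def mpoly_carrier_iff)
    define m' where "m' = m - Poly_Mapping.single i 1"
    have m_eq: "m = m' + Poly_Mapping.single i 1"
      using i(1) by (intro poly_mapping_eqI)
        (auto simp: m'_def lookup_add lookup_minus lookup_single when_def in_keys_iff)
    have "Poly_Mapping.single m' (Poly_Mapping.lookup p m) * mvar i \<in> Q"
    proof (rule ideal_mpoly_mult[OF Q])
      show "mvar i \<in> Q"
        using i mV by (intro var) auto
      show "Poly_Mapping.single m' (Poly_Mapping.lookup p m) \<in> carrier (mpoly_ring V)"
        using mV by (auto simp: mpoly_carrier_iff m_eq keys_plus_nat)
    qed
    then show ?thesis
      unfolding mvar_def mult_single m_eq[symmetric] by simp
  qed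
  then show "p \<in> Q"
    by (subst mpoly_eq_sum_single) (rule ideal_mpoly_sum[OF Q])
qed

text \<open>Through the case \<open>W = {}\<close>, primality of variable ideals becomes available
  for the target of the radical computation.\<close>

lemma max_irrelevant_ideal_eq_var_ideal:
  "max_irrelevant_ideal V = (var_ideal V {} :: ('v, 'k::comm_ring_1) mpoly set)"
proof -
  let ?R = "mpoly_ring V :: ('v, 'k) mpoly ring"
  let ?m = "max_irrelevant_ideal V :: ('v, 'k) mpoly set"
  interpret cring ?R
    by (rule cring_mpoly_ring)
  have sub: "mvar ` V \<subseteq> carrier ?R"
    using mpoly_carrier_mvar by (rule image_subsetI)
  have "var_ideal V {} \<subseteq> ?m"
  proof (rule var_ideal_subset)
    show "ideal ?m ?R"
      unfolding max_irrelevant_ideal_def using sub by (rule genideal_ideal)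
    show "mvar i \<in> ?m" if "i \<in> V - {}" for i
      using genideal_self[OF sub] that unfolding max_irrelevant_ideal_def by blast
  qed
  moreover have "?m \<subseteq> var_ideal V {}"
    unfolding max_irrelevant_ideal_def
    by (rule genideal_minimal[OF ideal_var_ideal]) (auto simp: mvar_mem_var_ideal_iff)
  ultimately show ?thesis
    by (rule equalityI[rotated])
qed

section \<open>Chains of primes over an ideal generated by variables\<close>

text \<open>Gaussian elimination, one coordinate \<open>m\<close> at a time: a vector
  \<open>f i0\<close> with nonzero entry at \<open>m\<close> serves as pivot and clears that entry
  in the others, which are still more numerous than the remaining coordinates.\<close>

lemma nontrivial_linear_relation:
  fixes f :: "'i \<Rightarrow> 'm \<Rightarrow> 'k::field"
  assumes "finite M" and "finite I" and "card M < card I"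
  shows "\<exists>c. (\<exists>i\<in>I. c i \<noteq> 0) \<and> (\<forall>m\<in>M. (\<Sum>i\<in>I. c i * f i m) = 0)"
  using assms
proof (induction M arbitrary: I f rule: finite_induct)
  case empty
  then have "I \<noteq> {}"
    by auto
  then show ?case
    by (intro exI[of _ "\<lambda>_. 1"]) auto
next
  case (insert m M)
  show ?case
  proof (cases "\<forall>i\<in>I. f i m = 0")
    case True
    then show ?thesis
      using insert.IH[of I f] insert.prems insert.hyps by auto
  next
    case False
    then obtain i0 where i0: "i0 \<in> I" "f i0 m \<noteq> 0"
      by blast
    define J where "J = I - {i0}"
    have fJ: "finite J" and "card M < card J"
      using insert.prems insert.hyps i0(1) by (auto simp: J_def)
    then obtain c where c: "\<exists>i\<in>J. c i \<noteq> 0"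
      "\<And>m'. m' \<in> M \<Longrightarrow> (\<Sum>i\<in>J. c i * (f i m' - f i m / f i0 m * f i0 m')) = 0"
      using insert.IH[of J "\<lambda>i m'. f i m' - f i m / f i0 m * f i0 m'"] by blast
    \<comment> \<open>The coefficient that the pivot vector acquires when the relation among the
      reduced vectors is expanded.\<close>
    define s where "s = - (\<Sum>i\<in>J. c i * (f i m / f i0 m))"
    define d where "d = c(i0 := s)"
    have sum_d: "(\<Sum>i\<in>I. d i * f i m') = s * f i0 m' + (\<Sum>i\<in>J. c i * f i m')" for m'
    proof -
      have "(\<Sum>i\<in>I. d i * f i m') = d i0 * f i0 m' + (\<Sum>i\<in>J. d i * f i m')"
        unfolding J_def using insert.prems(1) i0(1) by (rule sum.remove)
      also have "(\<Sum>i\<in>J. d i * f i m') = (\<Sum>i\<in>J. c i * f i m')"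
        by (rule sum.cong) (auto simp: d_def J_def)
      finally show ?thesis
        by (simp add: d_def)
    qed
    have eq: "s * f i0 m' + (\<Sum>i\<in>J. c i * f i m') =
        (\<Sum>i\<in>J. c i * (f i m' - f i m / f i0 m * f i0 m'))" for m'
      by (simp add: s_def algebra_simps sum_subtractf sum_distrib_left sum_distrib_right)
    have "(\<Sum>i\<in>I. d i * f i m') = 0" if "m' \<in> insert m M" for m'
      using that c(2) i0(2) by (auto simp: sum_d eq)
    moreover have "\<exists>i\<in>I. d i \<noteq> 0"
      using c(1) by (auto simp: d_def J_def)
    ultimately show ?thesis
      by blast
  qed
qed

section \<open>Algebraic dependence by counting monomials of bounded exponent\<close>

lemma exponents_bounded: "\<exists>D. \<forall>m\<in>Poly_Mapping.keys p. \<forall>i. Poly_Mapping.lookup m i \<le> D"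
  for p :: "('v, 'k::zero) mpoly"
proof (intro exI ballI allI)
  fix m i assume m: "m \<in> Poly_Mapping.keys p"
  have "Poly_Mapping.lookup m i \<le> (\<Sum>i\<in>Poly_Mapping.keys m. Poly_Mapping.lookup m i)"
    by (cases "i \<in> Poly_Mapping.keys m") (auto intro: member_le_sum simp: in_keys_iff)
  also have "\<dots> \<le> (\<Sum>m\<in>Poly_Mapping.keys p. \<Sum>i\<in>Poly_Mapping.keys m. Poly_Mapping.lookup m i)"
    using m by (intro member_le_sum) auto
  finally show "Poly_Mapping.lookup m i \<le>
      (\<Sum>m\<in>Poly_Mapping.keys p. \<Sum>i\<in>Poly_Mapping.keys m. Poly_Mapping.lookup m i)" .
qed

lemma exponents_mult_le:
  fixes p q :: "('v, 'k::comm_ring_1) mpoly"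
  assumes "\<And>m. m \<in> Poly_Mapping.keys p \<Longrightarrow> Poly_Mapping.lookup m i \<le> a"
    and "\<And>m. m \<in> Poly_Mapping.keys q \<Longrightarrow> Poly_Mapping.lookup m i \<le> b"
    and m: "m \<in> Poly_Mapping.keys (p * q)"
  shows "Poly_Mapping.lookup m i \<le> a + b"
proof -
  obtain k l where "m = k + l" "k \<in> Poly_Mapping.keys p" "l \<in> Poly_Mapping.keys q"
    using m keys_mult[of p q] by blast
  then show ?thesis
    using assms(1,2) by (simp add: lookup_add add_mono)
qed

lemma exponents_power_le:
  fixes p :: "('v, 'k::comm_ring_1) mpoly"
  assumes "\<And>m. m \<in> Poly_Mapping.keys p \<Longrightarrow> Poly_Mapping.lookup m i \<le> a"
  shows "m \<in> Poly_Mapping.keys (p ^ n) \<Longrightarrow> Poly_Mapping.lookup m i \<le> n * a"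
proof (induction n arbitrary: m)
  case (Suc n)
  then show ?case
    using exponents_mult_le[of p i a "p ^ n" "n * a" m] assms by simp
qed simp

text \<open>A monomial supported in \<open>W\<close> is determined by its exponents on
  \<open>W\<close>, a function from \<open>W\<close> to \<open>{..b}\<close>.\<close>

lemma card_bounded_monomials:
  assumes "finite W"
  shows "finite {m :: 'v \<Rightarrow>\<^sub>0 nat. Poly_Mapping.keys m \<subseteq> W \<and> (\<forall>i. Poly_Mapping.lookup m i \<le> b)}" (is "finite ?M")
    and "card {m :: 'v \<Rightarrow>\<^sub>0 nat. Poly_Mapping.keys m \<subseteq> W \<and> (\<forall>i. Poly_Mapping.lookup m i \<le> b)} \<le> (b + 1) ^ card W"
proof -
  let ?r = "\<lambda>m :: 'v \<Rightarrow>\<^sub>0 nat. restrict (Poly_Mapping.lookup m) W"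
  have inj: "inj_on ?r ?M"
  proof (rule inj_onI)
    fix m m' assume M: "m \<in> ?M" "m' \<in> ?M" and eq: "?r m = ?r m'"
    show "m = m'"
    proof (rule poly_mapping_eqI)
      fix i
      show "Poly_Mapping.lookup m i = Poly_Mapping.lookup m' i"
      proof (cases "i \<in> W")
        case True
        then show ?thesis
          using fun_cong[OF eq, of i] by simp
      next
        case False
        then have "i \<notin> Poly_Mapping.keys m" "i \<notin> Poly_Mapping.keys m'"
          using M by auto
        then show ?thesis
          by (simp add: in_keys_iff)
      qed
    qed
  qed
  have image: "?r ` ?M \<subseteq> W \<rightarrow>\<^sub>E {..b}"
    by auto
  have fin: "finite (W \<rightarrow>\<^sub>E {..b})"
    using assms by (simp add: finite_PiE)
  show "finite ?M"
    using inj image fin by (rule inj_on_finite)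
  have "card ?M \<le> card (W \<rightarrow>\<^sub>E {..b})"
    using inj image fin by (rule card_inj_on_le)
  also have "\<dots> = (b + 1) ^ card W"
    using assms by (simp add: card_PiE)
  finally show "card ?M \<le> (b + 1) ^ card W" .
qed

text \<open>Among the \<open>N ^ 3\<close> products of powers below \<open>N\<close>, only
  coefficients at monomials on \<open>W\<close> matter modulo the ideal, and there are fewer of
  those monomials than products. A linear relation between these coefficients gives the polynomial
  relation. The nested form of the sum lets one element at a time be cancelled later.\<close>

lemma algebraically_dependent_mod_var_ideal:
  fixes x y z :: "('v, 'k::field) mpoly"
  assumes W: "finite W" "card W \<le> 2"
    and C: "x \<in> carrier (mpoly_ring V)" "y \<in> carrier (mpoly_ring V)" "z \<in> carrier (mpoly_ring V)"
  obtains N q where "\<exists>i<N. \<exists>j<N. \<exists>k<N. q i j k \<noteq> 0"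
    and "(\<Sum>i<N. x ^ i * (\<Sum>j<N. y ^ j * (\<Sum>k<N. z ^ k * mconst (q i j k)))) \<in> var_ideal V W"
proof -
  obtain Dx Dy Dz where
    "\<forall>m\<in>Poly_Mapping.keys x. \<forall>i. Poly_Mapping.lookup m i \<le> Dx"
    "\<forall>m\<in>Poly_Mapping.keys y. \<forall>i. Poly_Mapping.lookup m i \<le> Dy"
    "\<forall>m\<in>Poly_Mapping.keys z. \<forall>i. Poly_Mapping.lookup m i \<le> Dz"
    using exponents_bounded[of x] exponents_bounded[of y] exponents_bounded[of z] by blast
  note D = this
  define D where "D = Dx + Dy + Dz"
  \<comment> \<open>Chosen so that \<open>(N * D + 1) ^ 2 \<le> N ^ 2 * (D + 1) ^ 2 < N ^ 3\<close>;
    exponents in the products are at most \<open>N * D\<close>.\<close>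
  define N where "N = (D + 1)\<^sup>2 + 1"
  define v where "v = (\<lambda>(i, j, k). x ^ i * (y ^ j * z ^ k))"
  define I where "I = {..<N} \<times> {..<N} \<times> {..<N}"
  define M where "M = {m :: 'v \<Rightarrow>\<^sub>0 nat. Poly_Mapping.keys m \<subseteq> W \<and> (\<forall>i. Poly_Mapping.lookup m i \<le> N * D)}"
  have M: "finite M" "card M \<le> (N * D + 1) ^ card W"
    unfolding M_def by (rule card_bounded_monomials[OF W(1)])+
  have v_le: "Poly_Mapping.lookup m h \<le> N * D" if t: "t \<in> I" and m: "m \<in> Poly_Mapping.keys (v t)" for t m h
  proof -
    obtain i j k where t_eq: "t = (i, j, k)"
      by (cases t)
    then have "i \<le> N" "j \<le> N" "k \<le> N"
      using t by (auto simp: I_def)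
    have "Poly_Mapping.lookup m h \<le> i * Dx + (j * Dy + k * Dz)"
      using m unfolding v_def t_eq split
      by (intro exponents_mult_le exponents_power_le) (use D in auto)
    also have "\<dots> \<le> N * Dx + (N * Dy + N * Dz)"
      using \<open>i \<le> N\<close> \<open>j \<le> N\<close> \<open>k \<le> N\<close> by (intro add_mono mult_le_mono1)
    finally show ?thesis
      by (simp add: D_def algebra_simps)
  qed
  have "card M \<le> (N * D + 1) ^ 2"
    using M(2) power_increasing[OF W(2), of "N * D + 1"] by simp
  also have "\<dots> \<le> (N * (D + 1)) ^ 2"
    by (intro power_mono) (auto simp: N_def)
  also have "\<dots> = N ^ 2 * (D + 1) ^ 2"
    by (rule power_mult_distrib)
  also have "\<dots> < N ^ 2 * N"
    by (rule mult_strict_left_mono) (simp_all add: N_def)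
  also have "\<dots> = N ^ 3"
    by (simp add: power2_eq_square power3_eq_cube)
  also have "\<dots> = card I"
    by (simp add: I_def power3_eq_cube)
  finally obtain c where c: "\<exists>t\<in>I. c t \<noteq> 0"
    "\<And>m. m \<in> M \<Longrightarrow> (\<Sum>t\<in>I. c t * Poly_Mapping.lookup (v t) m) = 0"
    using nontrivial_linear_relation[OF M(1), of I "\<lambda>t. Poly_Mapping.lookup (v t)"]
    by (auto simp: I_def)
  define p where "p = (\<Sum>t\<in>I. mconst (c t) * v t)"
  have "p \<in> carrier (mpoly_ring V)"
    unfolding p_def v_def using C
    by (intro mpoly_carrier_sum)
      (auto intro!: mpoly_carrier_mult mpoly_carrier_mconst mpoly_carrier_power)
  moreover have "\<not> Poly_Mapping.keys m \<subseteq> W" if m: "m \<in> Poly_Mapping.keys p" for m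
  proof
    assume "Poly_Mapping.keys m \<subseteq> W"
    have lookup_p: "Poly_Mapping.lookup p m = (\<Sum>t\<in>I. c t * Poly_Mapping.lookup (v t) m)"
      by (simp add: p_def lookup_sum lookup_mconst_mult)
    with m have "(\<Sum>t\<in>I. c t * Poly_Mapping.lookup (v t) m) \<noteq> 0"
      by (simp add: in_keys_iff)
    then obtain t where "t \<in> I" "c t * Poly_Mapping.lookup (v t) m \<noteq> 0"
      by (rule sum.not_neutral_contains_not_neutral)
    then have "m \<in> Poly_Mapping.keys (v t)"
      by (simp add: in_keys_iff)
    then have "m \<in> M"
      using v_le[OF \<open>t \<in> I\<close>] \<open>Poly_Mapping.keys m \<subseteq> W\<close> by (simp add: M_def)
    then show False
      using c(2) lookup_p m by (simp add: in_keys_iff)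
  qed
  ultimately have "p \<in> var_ideal V W"
    by (simp add: var_ideal_def)
  moreover have "p = (\<Sum>i<N. x ^ i * (\<Sum>j<N. y ^ j * (\<Sum>k<N. z ^ k * mconst (c (i, j, k)))))"
    by (simp add: p_def I_def v_def sum.cartesian_product sum_distrib_left split_def ac_simps)
  ultimately show ?thesis
    using c(1) by (intro that[of N "\<lambda>i j k. c (i, j, k)"]) (auto simp: I_def)
qed

text \<open>The terms below \<open>r\<close> vanish, so \<open>x ^ r\<close> factors out of the sum.
  Primality of \<open>P\<close> and \<open>x \<notin> P\<close> cancel it, which leaves
  \<open>g r + x * h\<close> in \<open>P\<close>; in the larger ideal \<open>P'\<close> the part
  \<open>x * h\<close> can be subtracted.\<close>

lemma lowest_coeff_mem:
  fixes x :: "('v, 'k::comm_ring_1) mpoly"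
  assumes P: "primeideal P (mpoly_ring V)" and P': "ideal P' (mpoly_ring V)" and "P \<subseteq> P'"
    and x: "x \<in> P'" "x \<notin> P"
    and g: "\<And>i. i < N \<Longrightarrow> g i \<in> carrier (mpoly_ring V)"
    and sum: "(\<Sum>i<N. x ^ i * g i) \<in> P"
    and r: "r < N" "\<And>i. i < r \<Longrightarrow> g i = 0"
  shows "g r \<in> P'"
proof -
  have xC: "x \<in> carrier (mpoly_ring V)"
    using x(1) ideal_mpoly_subset[OF P'] by blast
  define h where "h = (\<Sum>i\<in>{Suc r..<N}. x ^ (i - Suc r) * g i)"
  have hC: "h \<in> carrier (mpoly_ring V)"
    unfolding h_def using g xC
    by (intro mpoly_carrier_sum mpoly_carrier_mult mpoly_carrier_power) auto
  have "(\<Sum>i<N. x ^ i * g i) = (\<Sum>i\<in>{r..<N}. x ^ i * g i)"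
    using r(2) by (intro sum.mono_neutral_right) auto
  also have "\<dots> = x ^ r * g r + (\<Sum>i\<in>{Suc r..<N}. x ^ i * g i)"
    using r(1) by (rule sum.atLeast_Suc_lessThan)
  also have "(\<Sum>i\<in>{Suc r..<N}. x ^ i * g i) = (\<Sum>i\<in>{Suc r..<N}. x ^ r * (x * (x ^ (i - Suc r) * g i)))"
  proof (rule sum.cong[OF refl])
    fix i assume "i \<in> {Suc r..<N}"
    then have "x ^ i = x ^ (r + Suc (i - Suc r))"
      by simp
    then show "x ^ i * g i = x ^ r * (x * (x ^ (i - Suc r) * g i))"
      unfolding power_add power_Suc by (simp only: mult.assoc)
  qed
  also have "x ^ r * g r + \<dots> = x ^ r * (g r + x * h)"
    by (simp add: h_def distrib_left sum_distrib_left)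
  finally have "x ^ r * (g r + x * h) \<in> P"
    using sum by simp
  moreover have "x ^ r \<notin> P"
    using primeideal_mpoly_power[OF P xC] x(2) by blast
  moreover have "g r + x * h \<in> carrier (mpoly_ring V)"
    by (intro mpoly_carrier_add mpoly_carrier_mult xC hC g r(1))
  ultimately have "g r + x * h \<in> P"
    using P mpoly_carrier_power[OF xC] unfolding primeideal_mpoly_ring_iff by blast
  then have "g r + x * h - h * x \<in> P'"
    using \<open>P \<subseteq> P'\<close> by (intro ideal_mpoly_diff[OF P'] ideal_mpoly_mult[OF P'] hC x(1)) auto
  then show ?thesis
    by (simp add: mult.commute)
qed

lemma no_prime_chain_above_var_ideal:
  fixes P :: "nat \<Rightarrow> ('v, 'k::field) mpoly set"
  assumes W: "finite W" "card W \<le> 2"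
    and P: "\<And>i. i \<le> 3 \<Longrightarrow> primeideal (P i) (mpoly_ring V)"
    and chain: "\<And>i. i < 3 \<Longrightarrow> P i \<subset> P (Suc i)"
    and sub: "var_ideal V W \<subseteq> P 0"
  shows False
proof -
  have id: "ideal (P i) (mpoly_ring V)" if "i \<le> 3" for i
    using P[OF that] by (simp add: primeideal_mpoly_ring_iff)
  have "\<exists>x. x \<in> P (Suc i) \<and> x \<notin> P i" if "i < 3" for i
    using chain[OF that] by blast
  then obtain x where x: "\<And>i. i < 3 \<Longrightarrow> x i \<in> P (Suc i)" "\<And>i. i < 3 \<Longrightarrow> x i \<notin> P i"
    by metis
  have xC: "x i \<in> carrier (mpoly_ring V)" if "i < 3" for i
    using x(1)[OF that] ideal_mpoly_subset[OF id, of "Suc i"] that by auto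
  have xC012: "x 0 \<in> carrier (mpoly_ring V)" "x 1 \<in> carrier (mpoly_ring V)" "x 2 \<in> carrier (mpoly_ring V)"
    by (simp_all add: xC)
  obtain N q where q: "\<exists>i<N. \<exists>j<N. \<exists>k<N. q i j k \<noteq> 0"
    and rel: "(\<Sum>i<N. x 0 ^ i * (\<Sum>j<N. x 1 ^ j * (\<Sum>k<N. x 2 ^ k * mconst (q i j k)))) \<in> var_ideal V W"
    by (rule algebraically_dependent_mod_var_ideal[OF W xC012])
  define g2 where "g2 i j = (\<Sum>k<N. x 2 ^ k * mconst (q i j k))" for i j
  define g1 where "g1 i = (\<Sum>j<N. x 1 ^ j * g2 i j)" for i
  have g2C: "g2 i j \<in> carrier (mpoly_ring V)" for i j
    unfolding g2_def by (intro mpoly_carrier_sum mpoly_carrier_mult mpoly_carrier_power mpoly_carrier_mconst xC) simp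
  have g1C: "g1 i \<in> carrier (mpoly_ring V)" for i
    unfolding g1_def by (intro mpoly_carrier_sum mpoly_carrier_mult mpoly_carrier_power g2C xC) simp
  \<comment> \<open>Successive minimal choices make \<open>(r, s, t)\<close> the lexicographically
    least exponent triple with nonzero coefficient, so that at each of the three descents all lower
    coefficients are zero.\<close>
  obtain r where "r < N" and r: "\<exists>j<N. \<exists>k<N. q r j k \<noteq> 0"
    and "\<forall>i<r. \<not> (i < N \<and> (\<exists>j<N. \<exists>k<N. q i j k \<noteq> 0))"
    using q exists_least_iff[of "\<lambda>i. i < N \<and> (\<exists>j<N. \<exists>k<N. q i j k \<noteq> 0)"] by blast
  then have r0: "q i j k = 0" if "i < r" "j < N" "k < N" for i j k
    using that by (meson less_trans)
  obtain s where "s < N" and s: "\<exists>k<N. q r s k \<noteq> 0"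
    and "\<forall>j<s. \<not> (j < N \<and> (\<exists>k<N. q r j k \<noteq> 0))"
    using r exists_least_iff[of "\<lambda>j. j < N \<and> (\<exists>k<N. q r j k \<noteq> 0)"] by blast
  then have s0: "q r j k = 0" if "j < s" "k < N" for j k
    using that by (meson less_trans)
  obtain t where "t < N" and t: "q r s t \<noteq> 0"
    and "\<forall>k<t. \<not> (k < N \<and> q r s k \<noteq> 0)"
    using s exists_least_iff[of "\<lambda>k. k < N \<and> q r s k \<noteq> 0"] by blast
  then have t0: "q r s k = 0" if "k < t" for k
    using that by (meson less_trans)
  have sub01: "P 0 \<subseteq> P 1" and sub12: "P 1 \<subseteq> P 2" and sub23: "P 2 \<subseteq> P 3"
    using chain[of 0] chain[of 1] chain[of 2] by (simp_all add: psubset_imp_subset eval_nat_numeral)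
  have x0: "x 0 \<in> P 1" "x 0 \<notin> P 0" and x1: "x 1 \<in> P 2" "x 1 \<notin> P 1"
    and x2: "x 2 \<in> P 3" "x 2 \<notin> P 2"
    using x[of 0] x[of 1] x[of 2] by (simp_all add: eval_nat_numeral)
  have P012: "primeideal (P 0) (mpoly_ring V)" "primeideal (P 1) (mpoly_ring V)"
    "primeideal (P 2) (mpoly_ring V)"
    by (simp_all add: P)
  have id123: "ideal (P 1) (mpoly_ring V)" "ideal (P 2) (mpoly_ring V)" "ideal (P 3) (mpoly_ring V)"
    by (simp_all add: id)
  have "g1 r \<in> P 1"
  proof (rule lowest_coeff_mem[OF P012(1) id123(1) sub01 x0 g1C _ \<open>r < N\<close>])
    show "(\<Sum>i<N. x 0 ^ i * g1 i) \<in> P 0"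
      using rel sub unfolding g1_def g2_def by blast
    show "g1 i = 0" if "i < r" for i
      using r0[OF that] by (simp add: g1_def g2_def mconst_def)
  qed
  then have sum1: "(\<Sum>j<N. x 1 ^ j * g2 r j) \<in> P 1"
    by (simp only: g1_def)
  have "g2 r s \<in> P 2"
  proof (rule lowest_coeff_mem[OF P012(2) id123(2) sub12 x1 g2C sum1 \<open>s < N\<close>])
    show "g2 r j = 0" if "j < s" for j
      using s0[OF that] by (simp add: g2_def mconst_def)
  qed
  then have sum2: "(\<Sum>k<N. x 2 ^ k * mconst (q r s k)) \<in> P 2"
    by (simp only: g2_def)
  have "mconst (q r s t) \<in> P 3"
  proof (rule lowest_coeff_mem[OF P012(3) id123(3) sub23 x2 mpoly_carrier_mconst sum2 \<open>t < N\<close>])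
    show "mconst (q r s k) = 0" if "k < t" for k
      using t0[OF that] by (simp add: mconst_def)
  qed
  \<comment> \<open>The product is \<open>1\<close>, which no prime contains.\<close>
  then have "mconst (inverse (q r s t)) * mconst (q r s t) \<in> P 3"
    by (rule ideal_mpoly_mult[OF id123(3) mpoly_carrier_mconst])
  then show False
    using P[of 3] t by (simp add: mconst_def mult_single primeideal_mpoly_ring_iff)
qed

section \<open>Edge ideals\<close>

text \<open>\<open>Q\<close> stands for the radical, of which only closure under square roots is
  used. The sets \<open>B\<close> are the supports of the linear forms; \<open>cover\<close> and
  \<open>sep\<close> say that the coefficient vectors are nonzero and differ at non-adjacent
  vertices.\<close>

lemma vars_mem_of_separating_sums:
  fixes Q :: "('v, 'k::comm_ring_1) mpoly set" and \<B> :: "'v set set"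
  assumes V: "finite V" and Q: "ideal Q (mpoly_ring V)"
    and rad: "\<And>p. p \<in> carrier (mpoly_ring V) \<Longrightarrow> p ^ 2 \<in> Q \<Longrightarrow> p \<in> Q"
    and edge: "\<And>i j. {i, j} \<in> E \<Longrightarrow> mvar i * mvar j \<in> Q"
    and sums: "\<And>B. B \<in> \<B> \<Longrightarrow> (\<Sum>j\<in>B. mvar j) \<in> Q"
    and subset: "\<And>B. B \<in> \<B> \<Longrightarrow> B \<subseteq> V"
    and cover: "\<And>u. u \<in> V \<Longrightarrow> \<exists>B\<in>\<B>. u \<in> B"
    and sep: "\<And>u v. u \<in> V \<Longrightarrow> v \<in> V \<Longrightarrow> u \<noteq> v \<Longrightarrow> {u, v} \<notin> E \<Longrightarrow> \<exists>B\<in>\<B>. (u \<in> B) \<noteq> (v \<in> B)"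
    and tri: "\<And>u v w. u \<in> V \<Longrightarrow> v \<in> V \<Longrightarrow> w \<in> V \<Longrightarrow> distinct [u, v, w] \<Longrightarrow>
        {u, v} \<in> E \<or> {u, w} \<in> E \<or> {v, w} \<in> E"
    and u: "u \<in> V"
  shows "mvar u \<in> Q"
proof -
  note mvarC = mpoly_carrier_mvar[of _ V]
  \<comment> \<open>Isolates one term of a form: once \<open>p\<close> sends all other variables of
    \<open>B\<close> into \<open>Q\<close>, it sends the last one there too.\<close>
  have aux: "p * mvar a \<in> Q"
    if p: "p \<in> carrier (mpoly_ring V)" and B: "B \<in> \<B>" "a \<in> B"
      and others: "\<And>j. j \<in> B - {a} \<Longrightarrow> p * mvar j \<in> Q" for p a B
  proof -
    have "finite B"
      using subset[OF B(1)] V by (rule finite_subset)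
    then have "p * (\<Sum>j\<in>B. mvar j) - (\<Sum>j\<in>B - {a}. p * mvar j) = p * mvar a"
      using B(2) by (simp add: sum.remove distrib_left sum_distrib_left)
    moreover have "p * (\<Sum>j\<in>B. mvar j) - (\<Sum>j\<in>B - {a}. p * mvar j) \<in> Q"
      by (intro ideal_mpoly_diff[OF Q] ideal_mpoly_mult[OF Q] ideal_mpoly_sum[OF Q] p sums B others)
    ultimately show ?thesis
      by simp
  qed
  have separated: "mvar u * mvar v \<in> Q"
    if uv: "u \<in> V" "v \<in> V" and nE: "{u, v} \<notin> E" and B: "B \<in> \<B>" "u \<in> B" "v \<notin> B" for u v B
  proof -
    have "(mvar u * mvar v) * mvar u \<in> Q"
    proof (rule aux[OF _ B(1,2)])
      show "mvar u * mvar v \<in> carrier (mpoly_ring V)"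
        using uv by (intro mpoly_carrier_mult mvarC)
      fix j assume j: "j \<in> B - {u}"
      then have jV: "j \<in> V"
        using subset[OF B(1)] by blast
      \<comment> \<open>Here \<open>j\<close> differs from \<open>v\<close> because
        \<open>v \<notin> B\<close>, so \<open>u\<close>, \<open>v\<close>, \<open>j\<close> are
        three vertices of which the first two are not adjacent.\<close>
      have "{u, j} \<in> E \<or> {v, j} \<in> E"
        using tri[OF uv jV] j B nE by auto
      then show "mvar u * mvar v * mvar j \<in> Q"
      proof
        assume "{u, j} \<in> E"
        then have "mvar v * (mvar u * mvar j) \<in> Q"
          by (intro ideal_mpoly_mult[OF Q] mvarC uv edge)
        then show ?thesis
          by (simp add: ac_simps)
      next
        assume "{v, j} \<in> E"
        then have "mvar u * (mvar v * mvar j) \<in> Q"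
          by (intro ideal_mpoly_mult[OF Q] mvarC uv edge)
        then show ?thesis
          by (simp add: ac_simps)
      qed
    qed
    \<comment> \<open>The extra factor \<open>mvar v\<close> completes a square, from which the root
      can be taken.\<close>
    then have "mvar v * (mvar u * mvar v * mvar u) \<in> Q"
      by (rule ideal_mpoly_mult[OF Q mvarC[OF uv(2)]])
    then have "(mvar u * mvar v) ^ 2 \<in> Q"
      by (simp add: power2_eq_square ac_simps)
    then show ?thesis
      by (rule rad[OF mpoly_carrier_mult[OF mvarC[OF uv(1)] mvarC[OF uv(2)]]])
  qed
  have products: "mvar u * mvar v \<in> Q" if uv: "u \<in> V" "v \<in> V" "u \<noteq> v" for u v
  proof (cases "{u, v} \<in> E")
    case False
    then obtain B where "B \<in> \<B>" "(u \<in> B) \<noteq> (v \<in> B)"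
      using sep[OF uv] by blast
    then consider "u \<in> B" "v \<notin> B" | "v \<in> B" "u \<notin> B"
      by blast
    then show ?thesis
    proof cases
      case 1
      then show ?thesis
        using separated[of u v B] uv False \<open>B \<in> \<B>\<close> by blast
    next
      case 2
      then have "mvar v * mvar u \<in> Q"
        using separated[of v u B] uv False \<open>B \<in> \<B>\<close> by (simp add: insert_commute)
      then show ?thesis
        by (simp add: mult.commute)
    qed
  qed (rule edge)
  obtain B where B: "B \<in> \<B>" "u \<in> B"
    using cover[OF u] by blast
  \<comment> \<open>All mixed products are in \<open>Q\<close> by now, so multiplying the form on
    \<open>B\<close> by \<open>mvar u\<close> leaves only the square.\<close>
  have "mvar u * mvar u \<in> Q"
    using products u subset[OF B(1)] by (intro aux[OF mvarC[OF u] B]) auto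
  then show ?thesis
    using rad[OF mvarC[OF u]] by (simp add: power2_eq_square)
qed

section \<open>Generators and Krull dimension of edge ideals\<close>

context
  fixes V :: "'v set" and E :: "'v set set"
  assumes edges: "\<And>e. e \<in> E \<Longrightarrow> e \<subseteq> V"
begin

text \<open>The facts about generated ideals require generators in the carrier; this is where edges
  being subsets of \<open>V\<close> enters.\<close>

lemma edge_products_subset:
  "{mvar i * mvar j | i j. {i, j} \<in> E} \<subseteq> carrier (mpoly_ring V :: ('v, 'k::comm_ring_1) mpoly ring)"
proof safe
  fix i j assume "{i, j} \<in> E"
  then show "mvar i * mvar j \<in> carrier (mpoly_ring V :: ('v, 'k) mpoly ring)"
    using edges[of "{i, j}"] by (intro mpoly_carrier_mult mpoly_carrier_mvar) auto
qed

lemma ideal_edge_ideal: "ideal (edge_ideal V E :: ('v, 'k::comm_ring_1) mpoly set) (mpoly_ring V)"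
  unfolding edge_ideal_def
  by (rule ring.genideal_ideal[OF cring.axioms(1)[OF cring_mpoly_ring] edge_products_subset])

lemma edge_product_mem:
  assumes "{i, j} \<in> E"
  shows "(mvar i * mvar j :: ('v, 'k::comm_ring_1) mpoly) \<in> edge_ideal V E"
  using ring.genideal_self[OF cring.axioms(1)[OF cring_mpoly_ring] edge_products_subset] assms
  unfolding edge_ideal_def by blast

lemma edge_ideal_minimal:
  fixes Q :: "('v, 'k::comm_ring_1) mpoly set"
  assumes "ideal Q (mpoly_ring V)" and "\<And>i j. {i, j} \<in> E \<Longrightarrow> mvar i * mvar j \<in> Q"
  shows "edge_ideal V E \<subseteq> Q"
  unfolding edge_ideal_def
  by (rule ring.genideal_minimal[OF cring.axioms(1)[OF cring_mpoly_ring] assms(1)]) (use assms(2) in blast)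

end

lemma edge_ideal_subset_var_ideal:
  assumes "\<And>e. e \<in> E \<Longrightarrow> e \<subseteq> V \<and> \<not> e \<subseteq> W"
  shows "edge_ideal V E \<subseteq> (var_ideal V W :: ('v, 'k::comm_ring_1) mpoly set)"
proof (rule edge_ideal_minimal)
  fix i j assume "{i, j} \<in> E"
  then show "mvar i * mvar j \<in> (var_ideal V W :: ('v, 'k) mpoly set)"
    using assms[of "{i, j}"] by (intro mvar_mult_mem_var_ideal) auto
qed (use assms ideal_var_ideal in auto)

text \<open>Upper bound: the variables outside a prime over the edge ideal form an independent set,
  which \<open>tri\<close> limits to two elements, so the prime contains a variable ideal to which
  the chain bound applies. Lower bound: an explicit chain of variable ideals built from the
  independent pair \<open>u\<close>, \<open>v\<close>.\<close>

lemma krull_dim_edge_ideal: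
  fixes V :: "'v::linorder set"
  assumes V: "finite V" and edges: "\<And>e. e \<in> E \<Longrightarrow> e \<subseteq> V \<and> card e = 2"
    and uv: "u \<in> V" "v \<in> V" "u \<noteq> v" "{u, v} \<notin> E"
    and tri: "\<And>a b c. a \<in> V \<Longrightarrow> b \<in> V \<Longrightarrow> c \<in> V \<Longrightarrow> distinct [a, b, c] \<Longrightarrow>
        {a, b} \<in> E \<or> {a, c} \<in> E \<or> {b, c} \<in> E"
  shows "krull_dim (mpoly_ring V Quot (edge_ideal V E :: ('v, 'k::field) mpoly set)) = enat 2"
proof -
  let ?R = "mpoly_ring V :: ('v, 'k) mpoly ring"
  let ?I = "edge_ideal V E :: ('v, 'k) mpoly set"
  have subV: "e \<subseteq> V" if "e \<in> E" for e
    using edges[OF that] by blast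
  let ?L = "{l. \<exists>P. (\<forall>i\<le>l. primeideal (P i) ?R \<and> ?I \<subseteq> P i) \<and> (\<forall>i<l. P i \<subset> P (Suc i))}"
  have "l \<le> 2" if l: "l \<in> ?L" for l :: nat
  proof (rule ccontr)
    assume "\<not> l \<le> 2"
    then have l3: "3 \<le> l"
      by simp
    obtain P where P: "\<And>i. i \<le> l \<Longrightarrow> primeideal (P i) ?R" "\<And>i. i \<le> l \<Longrightarrow> ?I \<subseteq> P i"
      "\<And>i. i < l \<Longrightarrow> P i \<subset> P (Suc i)"
      using l by blast
    have P0: "primeideal (P 0) ?R" and I0: "?I \<subseteq> P 0"
      using P by blast+
    have id0: "ideal (P 0) ?R"
      using P0 by (simp add: primeideal_mpoly_ring_iff)
    define W where "W = {i \<in> V. mvar i \<notin> P 0}"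
    have W_nE: "{a, b} \<notin> E" if ab: "a \<in> W" "b \<in> W" for a b
    proof
      assume abE: "{a, b} \<in> E"
      have "mvar a * mvar b \<in> P 0"
        using edge_product_mem[OF subV abE] I0 by blast
      moreover have "mvar a \<in> carrier ?R" "mvar b \<in> carrier ?R"
        using ab by (auto simp: W_def mpoly_carrier_mvar)
      ultimately have "mvar a \<in> P 0 \<or> mvar b \<in> P 0"
        using P0 unfolding primeideal_mpoly_ring_iff by blast
      then show False
        using ab by (simp add: W_def)
    qed
    have W_fin: "finite W"
      using V by (simp add: W_def)
    have W_card: "card W \<le> 2"
    proof (rule ccontr)
      assume "\<not> card W \<le> 2"
      then obtain S where S: "S \<subseteq> W" "card S = 3"
        using obtain_subset_with_card_n[of 3 W] by auto
      then obtain a b c where abc: "S = {a, b, c}" "a \<noteq> b" "a \<noteq> c" "b \<noteq> c"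
        by (auto simp: card_3_iff)
      then have "a \<in> W" "b \<in> W" "c \<in> W"
        using S(1) by auto
      then show False
        using tri[of a b c] W_nE abc by (auto simp: W_def)
    qed
    have W_sub: "var_ideal V W \<subseteq> P 0"
      by (rule var_ideal_subset[OF id0]) (simp add: W_def)
    show False
      by (rule no_prime_chain_above_var_ideal[where P = P and V = V, OF W_fin W_card _ _ W_sub]) (use P l3 in auto)
  qed
  then have "(SUP l\<in>?L. enat l) \<le> enat 2"
    by (intro SUP_least) simp
  moreover have "enat 2 \<le> (SUP l\<in>?L. enat l)"
  proof (rule SUP_upper)
    \<comment> \<open>The surviving variables shrink, so the ideals grow; each strict step is
      witnessed by the variable just dropped.\<close>
    define Ws where "Ws i = (if i = 0 then {u, v} else if i = 1 then {u} else {})" for i :: nat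
    define P where "P i = (var_ideal V (Ws i) :: ('v, 'k) mpoly set)" for i
    have "primeideal (P i) ?R" for i
      unfolding P_def by (rule primeideal_var_ideal)
    moreover have "?I \<subseteq> P i" for i
      unfolding P_def
    proof (rule edge_ideal_subset_var_ideal)
      fix e assume e: "e \<in> E"
      obtain a b where ab: "e = {a, b}" "a \<noteq> b"
        using edges[OF e] by (auto simp: card_2_iff)
      have "e \<noteq> {u, v}"
        using e uv(4) by blast
      then have "\<not> e \<subseteq> Ws i"
        unfolding ab Ws_def using ab(2) by (auto split: if_splits)
      then show "e \<subseteq> V \<and> \<not> e \<subseteq> Ws i"
        using edges[OF e] by blast
    qed
    moreover have "P i \<subset> P (Suc i)" if "i < 2" for i
    proof
      show "P i \<subseteq> P (Suc i)"
        by (auto simp: P_def var_ideal_def Ws_def)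
      have "\<exists>a\<in>V. a \<in> Ws i \<and> a \<notin> Ws (Suc i)"
        using that uv by (cases i) (auto simp: Ws_def)
      then show "P i \<noteq> P (Suc i)"
        unfolding P_def by (metis mvar_mem_var_ideal_iff)
    qed
    ultimately show "2 \<in> ?L"
      by blast
  qed
  ultimately show ?thesis
    by (simp add: cring.krull_dim_quot[OF cring_mpoly_ring ideal_edge_ideal[OF subV]])
qed

section \<open>Zero-one forms and a combinatorial criterion for star-systems\<close>

lemma linear_form_sum_mvar:
  assumes "finite V" and "B \<subseteq> V"
  shows "linear_form V (\<Sum>j\<in>B. mvar j)"
  unfolding linear_form_def
proof
  have "(\<Sum>i\<in>V. mconst (if i \<in> B then 1 else 0) * mvar i) = (\<Sum>i\<in>V. if i \<in> B then mvar i else 0)"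
    by (intro sum.cong) (simp_all add: mconst_def)
  also have "\<dots> = (\<Sum>j\<in>B. mvar j)"
    using assms by (simp add: sum.If_cases Int_absorb1)
  finally show "(\<Sum>j\<in>B. mvar j) = (\<Sum>i\<in>V. mconst (if i \<in> B then 1 else 0) * mvar i)" ..
qed

text \<open>Distinct vertices give distinct monomials, so no monomial collects more than one
  coefficient \<open>1\<close>.\<close>

lemma lookup_sum_mvar_01:
  fixes B :: "'v set"
  assumes "finite B"
  shows "Poly_Mapping.lookup (\<Sum>j\<in>B. mvar j :: ('v, 'k::comm_ring_1) mpoly) m \<in> {0, 1}"
proof (cases "\<exists>i\<in>B. m = Poly_Mapping.single i 1")
  case True
  then obtain i where "i \<in> B" and m: "m = Poly_Mapping.single i 1"
    by blast
  have "Poly_Mapping.single j (1::nat) = Poly_Mapping.single i 1 \<longleftrightarrow> j = i" for j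
    using keys_single[of j "1::nat"] keys_single[of i "1::nat"] by (metis singleton_inject zero_neq_one)
  then have "Poly_Mapping.lookup (\<Sum>j\<in>B. mvar j :: ('v, 'k) mpoly) m = (\<Sum>j\<in>B. if j = i then 1 else 0)"
    unfolding lookup_sum mvar_def m lookup_single when_def by (intro sum.cong) simp_all
  then show ?thesis
    using assms \<open>i \<in> B\<close> by simp
next
  case False
  then have "Poly_Mapping.lookup (\<Sum>j\<in>B. mvar j :: ('v, 'k) mpoly) m = (\<Sum>j\<in>B. 0)"
    unfolding lookup_sum mvar_def lookup_single when_def by (intro sum.cong) auto
  then show ?thesis
    by simp
qed

text \<open>Reduces the theorem to combinatorics: it remains to choose supports \<open>B1\<close>,
  \<open>B2\<close> inside the stars of \<open>z1\<close>, \<open>z2\<close> that cover the vertices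
  and separate non-adjacent ones.\<close>

lemma star_sop_pair:
  fixes V :: "'v::linorder set"
  assumes V: "finite V" and edges: "\<And>e. e \<in> E \<Longrightarrow> e \<subseteq> V \<and> card e = 2"
    and tri: "\<And>a b c. a \<in> V \<Longrightarrow> b \<in> V \<Longrightarrow> c \<in> V \<Longrightarrow> distinct [a, b, c] \<Longrightarrow>
        {a, b} \<in> E \<or> {a, c} \<in> E \<or> {b, c} \<in> E"
    and z: "z1 \<noteq> z2" "{z1, z2} \<notin> E"
    and B: "B1 \<subseteq> V" "B2 \<subseteq> V" "z1 \<in> B1" "z2 \<in> B2"
    and nbh: "B1 - {z1} \<subseteq> neighbourhood E z1" "B2 - {z2} \<subseteq> neighbourhood E z2"
    and cover: "V \<subseteq> B1 \<union> B2"
    and sep: "\<And>a b. a \<in> V \<Longrightarrow> b \<in> V \<Longrightarrow> a \<noteq> b \<Longrightarrow> {a, b} \<notin> E \<Longrightarrow>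
        (a \<in> B1) \<noteq> (b \<in> B1) \<or> (a \<in> B2) \<noteq> (b \<in> B2)"
  shows "star_sop V E [z1, z2] [\<Sum>j\<in>B1. mvar j, \<Sum>j\<in>B2. mvar j :: ('v, 'k::field) mpoly]"
proof -
  let ?R = "mpoly_ring V :: ('v, 'k) mpoly ring"
  let ?I = "edge_ideal V E :: ('v, 'k) mpoly set"
  let ?m = "var_ideal V {} :: ('v, 'k) mpoly set"
  define f1 f2 :: "('v, 'k) mpoly" where "f1 = (\<Sum>j\<in>B1. mvar j)" and "f2 = (\<Sum>j\<in>B2. mvar j)"
  define J where "J = Idl\<^bsub>?R\<^esub> (?I \<union> {f1, f2})"
  interpret R: cring ?R
    by (rule cring_mpoly_ring)
  have fin: "finite B1" "finite B2"
    using B V finite_subset by blast+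
  have subV: "e \<subseteq> V" if "e \<in> E" for e
    using edges[OF that] by blast
  have idm: "ideal ?m ?R"
    by (rule ideal_var_ideal)
  have "mvar i \<in> ?m" if "i \<in> V" for i
    using that by (simp add: mvar_mem_var_ideal_iff)
  then have fm: "f1 \<in> ?m" "f2 \<in> ?m"
    unfolding f1_def f2_def using B(1,2) by (auto intro!: ideal_mpoly_sum[OF idm])
  have Im: "?I \<subseteq> ?m"
    using edges by (intro edge_ideal_subset_var_ideal) fastforce
  have sub: "?I \<union> {f1, f2} \<subseteq> carrier ?R"
    using fm Im ideal_mpoly_subset[OF idm] by blast
  have idJ: "ideal J ?R"
    unfolding J_def by (rule R.genideal_ideal[OF sub])
  have genJ: "?I \<subseteq> J" "f1 \<in> J" "f2 \<in> J"
    using R.genideal_self[OF sub] by (auto simp: J_def)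
  have Jm: "J \<subseteq> ?m"
    unfolding J_def by (rule R.genideal_minimal[OF idm]) (use fm Im in auto)
  have "radical ?R J = ?m"
  proof
    \<comment> \<open>The irrelevant ideal is itself a prime containing \<open>J\<close>.\<close>
    show "radical ?R J \<subseteq> ?m"
      by (rule radical_subset_primeideal[OF primeideal_var_ideal Jm])
    have idrad: "ideal (radical ?R J) ?R"
      by (rule ideal_radical[OF idJ])
    have Jrad: "J \<subseteq> radical ?R J"
      by (rule subset_radical[OF idJ])
    have "mvar u \<in> radical ?R J" if u: "u \<in> V" for u
    proof (rule vars_mem_of_separating_sums[OF V idrad _ _ _ _ _ _ tri u, where \<B> = "{B1, B2}"])
      show "p \<in> radical ?R J" if "p \<in> carrier ?R" "p ^ 2 \<in> radical ?R J" for p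
        by (rule radical_power[OF that]) simp
      show "mvar i * mvar j \<in> radical ?R J" if "{i, j} \<in> E" for i j
        using edge_product_mem[OF subV that] genJ(1) Jrad by blast
      show "(\<Sum>j\<in>B. mvar j) \<in> radical ?R J" if "B \<in> {B1, B2}" for B
        using that genJ(2,3) Jrad unfolding f1_def f2_def by blast
      show "\<exists>B\<in>{B1, B2}. (a \<in> B) \<noteq> (b \<in> B)" if "a \<in> V" "b \<in> V" "a \<noteq> b" "{a, b} \<notin> E" for a b
        using sep[OF that] by blast
    qed (use B cover in auto)
    then show "?m \<subseteq> radical ?R J"
      by (intro var_ideal_subset[OF idrad]) simp
  qed
  moreover have "krull_dim (?R Quot ?I) = enat 2"
    by (rule krull_dim_edge_ideal[OF V edges _ _ z tri]) (use B in auto)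
  ultimately have "linear_sop V E [f1, f2]"
    using linear_form_sum_mvar[OF V B(1)] linear_form_sum_mvar[OF V B(2)]
    unfolding linear_sop_def max_irrelevant_ideal_eq_var_ideal J_def f1_def f2_def by simp
  moreover have "\<forall>f\<in>set [f1, f2]. \<forall>m. Poly_Mapping.lookup f m \<in> {0, 1}"
    using lookup_sum_mvar_01[OF fin(1)] lookup_sum_mvar_01[OF fin(2)] by (auto simp: f1_def f2_def)
  ultimately have "zero_one_linear_sop V E [f1, f2]"
    unfolding zero_one_linear_sop_def by blast
  moreover have "f1 = mvar z1 + (\<Sum>j\<in>B1 - {z1}. mvar j)" "f2 = mvar z2 + (\<Sum>j\<in>B2 - {z2}. mvar j)"
    unfolding f1_def f2_def using fin B(3,4) by (intro sum.remove; simp)+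
  then have "\<forall>i<length [z1, z2]. \<exists>A. A \<subseteq> neighbourhood E ([z1, z2] ! i) \<and>
      [f1, f2] ! i = mvar ([z1, z2] ! i) + (\<Sum>j\<in>A. mvar j)"
    using nbh by (auto simp: less_Suc_eq)
  ultimately show ?thesis
    using z(1) B unfolding star_sop_def f1_def f2_def by auto
qed

section \<open>Cycles and their complements\<close>

text \<open>Allows a given edge of the cycle to be placed at positions \<open>0\<close> and
  \<open>1\<close>: a rotation permutes the positions and commutes with taking the cyclic
  successor.\<close>

lemma cycle_graph_rotate:
  fixes c :: "nat \<Rightarrow> 'v"
  assumes c: "bij_betw c {..<n} V" and i: "i < n"
  defines "c' \<equiv> \<lambda>j. c ((i + j) mod n)"
  shows "bij_betw c' {..<n} V"
    and "(\<lambda>j. {c' j, c' (Suc j mod n)}) ` {..<n} = (\<lambda>j. {c j, c (Suc j mod n)}) ` {..<n}"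
proof -
  define \<rho> where "\<rho> j = (i + j) mod n" for j
  have "\<rho> j = (if i + j < n then i + j else i + j - n)" if "j < n" for j
    using that i by (simp add: \<rho>_def mod_if)
  then have "inj_on \<rho> {..<n}"
    using i by (auto simp: inj_on_def split: if_splits)
  moreover have "\<rho> ` {..<n} \<subseteq> {..<n}"
    using i by (auto simp: \<rho>_def)
  ultimately have image: "\<rho> ` {..<n} = {..<n}"
    by (intro endo_inj_surj) simp_all
  then have "bij_betw \<rho> {..<n} {..<n}"
    using \<open>inj_on \<rho> {..<n}\<close> by (simp add: bij_betw_def)
  moreover have "c' = c \<circ> \<rho>"
    by (simp add: c'_def \<rho>_def fun_eq_iff)
  ultimately show "bij_betw c' {..<n} V"
    using bij_betw_trans[OF _ c] by blast
  have "{c' j, c' (Suc j mod n)} = (\<lambda>k. {c k, c (Suc k mod n)}) (\<rho> j)" for j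
    by (simp add: c'_def \<rho>_def mod_simps)
  then have "(\<lambda>j. {c' j, c' (Suc j mod n)}) ` {..<n} = (\<lambda>k. {c k, c (Suc k mod n)}) ` \<rho> ` {..<n}"
    by (simp add: image_image)
  then show "(\<lambda>j. {c' j, c' (Suc j mod n)}) ` {..<n} = (\<lambda>j. {c j, c (Suc j mod n)}) ` {..<n}"
    unfolding image .
qed

lemma cycle_edge_iff:
  assumes c: "bij_betw c {..<n} V" and ij: "i < n" "j < n"
  shows "{c i, c j} \<in> (\<lambda>i. {c i, c (Suc i mod n)}) ` {..<n} \<longleftrightarrow> j = Suc i mod n \<or> i = Suc j mod n"
proof
  have inj: "c a = c b \<longleftrightarrow> a = b" if "a < n" "b < n" for a b
    using bij_betw_imp_inj_on[OF c] that by (auto simp: inj_on_def)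
  assume "{c i, c j} \<in> (\<lambda>i. {c i, c (Suc i mod n)}) ` {..<n}"
  then obtain k where "k < n" "{c i, c j} = {c k, c (Suc k mod n)}"
    by auto
  moreover have "Suc k mod n < n"
    using ij by simp
  ultimately show "j = Suc i mod n \<or> i = Suc j mod n"
    using ij by (auto simp: doubleton_eq_iff inj)
next
  assume "j = Suc i mod n \<or> i = Suc j mod n"
  then show "{c i, c j} \<in> (\<lambda>i. {c i, c (Suc i mod n)}) ` {..<n}"
    using ij by (auto simp: insert_commute)
qed

theorem proposition4p14:
  fixes n :: nat and C G :: "nat set set" and z1 z2 :: nat
  assumes "n \<ge> 4"
    and "cycle_graph n {1..n} C"
    and "G = complement_edges {1..n} C"
    and "z1 \<noteq> z2"
    and "independent_set {1..n} G {z1, z2}"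
  shows "\<exists>fs :: (nat, 'k::field) mpoly list. star_sop {1..n} G [z1, z2] fs"
proof -
  let ?V = "{1..n}"
  obtain c0 where c0: "bij_betw c0 {..<n} ?V" and C0: "C = (\<lambda>i. {c0 i, c0 (Suc i mod n)}) ` {..<n}"
    using assms(2) by (auto simp: cycle_graph_def)
  have G_iff: "{a, b} \<in> G \<longleftrightarrow> {a, b} \<notin> C" if "a \<in> ?V" "b \<in> ?V" "a \<noteq> b" for a b
    using that by (simp add: assms(3) complement_edges_def)
  have z: "z1 \<in> ?V" "z2 \<in> ?V" "{z1, z2} \<notin> G"
    using assms(5) by (auto simp: independent_set_def)
  then have "{z1, z2} \<in> C"
    using G_iff assms(4) by blast
  then obtain i where i: "i < n" "{z1, z2} = {c0 i, c0 (Suc i mod n)}"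
    by (auto simp: C0)
  \<comment> \<open>An independent pair of the complement is an edge of the cycle; counting starts
    at that edge.\<close>
  define c where "c j = c0 ((i + j) mod n)" for j
  have c: "bij_betw c {..<n} ?V" and C: "C = (\<lambda>i. {c i, c (Suc i mod n)}) ` {..<n}"
    using cycle_graph_rotate[OF c0 i(1)] by (simp_all add: C0 c_def[abs_def])
  have z_c: "{z1, z2} = {c 0, c 1}"
    using i by (simp add: c_def)
  have inj: "c a = c b \<longleftrightarrow> a = b" if "a < n" "b < n" for a b
    using bij_betw_imp_inj_on[OF c] that by (auto simp: inj_on_def)
  have cV: "c a \<in> ?V" if "a < n" for a
    using bij_betw_apply[OF c] that by blast
  have Vc: "\<exists>a<n. v = c a" if "v \<in> ?V" for v
    using bij_betw_imp_surj_on[OF c] that by auto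
  have G_c: "{c a, c b} \<in> G \<longleftrightarrow> b \<noteq> Suc a mod n \<and> a \<noteq> Suc b mod n" if "a < n" "b < n" "a \<noteq> b" for a b
    using G_iff[OF cV cV, of a b] cycle_edge_iff[OF c that(1,2)] that inj by (simp add: C)
  have suc: "Suc a mod n = (if a = n - 1 then 0 else Suc a)" if "a < n" for a
    using that by auto
  \<comment> \<open>For even \<open>n\<close> these are the two parity classes. For odd \<open>n\<close> the last position may not lie in
    \<open>I1\<close>, being adjacent to \<open>0\<close>, so it is moved to \<open>I2\<close>, and position \<open>n - 2\<close> is put into both
    sets to keep it separated from its neighbour \<open>n - 1\<close>.\<close>
  define I1 where "I1 = {a. a < n \<and> (even a \<and> a \<le> n - 2 \<or> a = n - 2)}"
  define I2 where "I2 = {a. a < n \<and> (odd a \<or> a = n - 1)}"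
  define B1 where "B1 = c ` I1"
  define B2 where "B2 = c ` I2"
  have B_iff: "c a \<in> B1 \<longleftrightarrow> a \<in> I1" "c a \<in> B2 \<longleftrightarrow> a \<in> I2" if "a < n" for a
    using inj that by (auto simp: B1_def B2_def I1_def I2_def)
  have sub: "B1 \<subseteq> ?V" "B2 \<subseteq> ?V"
    using cV by (auto simp: B1_def B2_def I1_def I2_def)
  have edges: "e \<subseteq> ?V \<and> card e = 2" if "e \<in> G" for e
    using that by (simp add: assms(3) complement_edges_def)
  \<comment> \<open>Otherwise the cycle would contain a triangle, which happens only for
    \<open>n = 3\<close>.\<close>
  have tri: "{u, v} \<in> G \<or> {u, w} \<in> G \<or> {v, w} \<in> G"
    if uvw: "u \<in> ?V" "v \<in> ?V" "w \<in> ?V" "distinct [u, v, w]" for u v w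
  proof -
    obtain a b d where abd: "a < n" "u = c a" "b < n" "v = c b" "d < n" "w = c d"
      using uvw Vc by metis
    then have "a \<noteq> b" "a \<noteq> d" "b \<noteq> d"
      using uvw(4) by auto
    then show ?thesis
      using assms(1) abd by (auto simp: G_c suc split: if_splits)
  qed
  have nbh1: "B1 - {c 0} \<subseteq> neighbourhood G (c 0)"
  proof
    fix v assume "v \<in> B1 - {c 0}"
    then obtain a where a: "a \<in> I1" "v = c a" "a \<noteq> 0"
      by (auto simp: B1_def)
    \<comment> \<open>The odd position \<open>1\<close> could enter \<open>I1\<close> only as
      \<open>n - 2\<close>, that is, for \<open>n = 3\<close>.\<close>
    then have "a < n" "a \<noteq> 1" "a \<noteq> n - 1"
      using assms(1) by (auto simp: I1_def)
    then show "v \<in> neighbourhood G (c 0)"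
      using a assms(1) by (simp add: neighbourhood_def G_c suc)
  qed
  have nbh2: "B2 - {c 1} \<subseteq> neighbourhood G (c 1)"
  proof
    fix v assume "v \<in> B2 - {c 1}"
    then obtain a where a: "a \<in> I2" "v = c a" "a \<noteq> 1"
      by (auto simp: B2_def)
    \<comment> \<open>The even positions \<open>0\<close> and \<open>2\<close> could enter
      \<open>I2\<close> only as \<open>n - 1\<close>, which \<open>n \<ge> 4\<close>
      excludes.\<close>
    then have "a < n" "a \<noteq> 0" "a \<noteq> 2"
      using assms(1) by (auto simp: I2_def odd_pos)
    then show "v \<in> neighbourhood G (c 1)"
      using a assms(1) by (simp add: neighbourhood_def G_c suc)
  qed
  have cover: "?V \<subseteq> B1 \<union> B2"
  proof
    fix v assume "v \<in> ?V"
    then obtain a where "a < n" "v = c a"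
      using Vc by blast
    moreover have "a \<in> I1 \<or> a \<in> I2" if "a < n" for a
      using that by (cases "a = n - 1") (auto simp: I1_def I2_def)
    ultimately show "v \<in> B1 \<union> B2"
      using B_iff by blast
  qed
  \<comment> \<open>Parity separates neighbours away from the end. At the wrap-around,
    \<open>n - 1\<close> is only in \<open>I2\<close> and \<open>0\<close> only in
    \<open>I1\<close>. For odd \<open>n\<close>, \<open>I2\<close> separates \<open>n - 3\<close>
    from \<open>n - 2\<close>, and \<open>I1\<close> separates \<open>n - 2\<close> from
    \<open>n - 1\<close>.\<close>
  have sep_c: "(a \<in> I1) \<noteq> (Suc a mod n \<in> I1) \<or> (a \<in> I2) \<noteq> (Suc a mod n \<in> I2)" if a: "a < n" for a
  proof -
    consider "a = n - 1" | "a = n - 2" | "a < n - 2"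
      using a by linarith
    then show ?thesis
      by cases (use assms(1) in \<open>auto simp: suc I1_def I2_def\<close>)
  qed
  have sep: "(u \<in> B1) \<noteq> (v \<in> B1) \<or> (u \<in> B2) \<noteq> (v \<in> B2)"
    if uv: "u \<in> ?V" "v \<in> ?V" "u \<noteq> v" "{u, v} \<notin> G" for u v
  proof -
    obtain a b where ab: "a < n" "u = c a" "b < n" "v = c b"
      using uv(1,2) Vc by metis
    then have "b = Suc a mod n \<or> a = Suc b mod n"
      using G_c[of a b] uv(3,4) by auto
    then show ?thesis
      using sep_c[of a] sep_c[of b] ab B_iff by auto
  qed
  have c01: "c 0 \<in> B1" "c 1 \<in> B2" "c 0 \<noteq> c 1" "{c 0, c 1} \<notin> G"
    using assms(1) z(3) z_c inj[of 0 1] by (auto simp: B1_def B2_def I1_def I2_def)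
  \<comment> \<open>The rotation places the pair only as a set; in the second order the two supports
    are exchanged along with their centres.\<close>
  consider "z1 = c 0" "z2 = c 1" | "z1 = c 1" "z2 = c 0"
    using z_c by (auto simp: doubleton_eq_iff)
  then show ?thesis
  proof cases
    case 1
    have "star_sop ?V G [c 0, c 1] [\<Sum>j\<in>B1. mvar j, \<Sum>j\<in>B2. mvar j :: (nat, 'k) mpoly]"
      by (rule star_sop_pair[OF _ edges tri c01(3,4) sub c01(1,2) nbh1 nbh2 cover sep]) simp_all
    then show ?thesis
      unfolding 1 by blast
  next
    case 2
    have "star_sop ?V G [c 1, c 0] [\<Sum>j\<in>B2. mvar j, \<Sum>j\<in>B1. mvar j :: (nat, 'k) mpoly]"
    proof (rule star_sop_pair[OF _ edges tri _ _ sub(2,1) c01(2,1) nbh2 nbh1])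
      show "(u \<in> B2) \<noteq> (v \<in> B2) \<or> (u \<in> B1) \<noteq> (v \<in> B1)"
        if "u \<in> ?V" "v \<in> ?V" "u \<noteq> v" "{u, v} \<notin> G" for u v
        using sep[OF that] by blast
    qed (use c01 cover in \<open>auto simp: insert_commute\<close>)
    then show ?thesis
      unfolding 2 by blast
  qed
qed

end
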